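(* If $\phi\in L^2(\mathbb{R})$ is a wavelet and $(W^\alpha_\phi h)(a,b)$ denotes the general novel fractional wavelet transform (GNFrWT) of $h\in L^2(\mathbb{R})$, then for any functions $h,g\in L^2(\mathbb{R})$, $$\int_{\mathbb{R}}\int_{\mathbb{R}}(W^\alpha_\phi h)(a,b)\,\overline{(W^\alpha_\phi g)(a,b)}\,|a|^{2\rho-3}\,db\,da = C_\phi\,(h,g),$$ where $$0<C_\phi=\int_{\mathbb{R}}\frac{|\hat\phi(\omega)|^2}{|\omega|}\,d\omega<\infty .$$
   Context: Here $\theta=\alpha\pi/2$ is the angle attached to the fractional order $\alpha$ (with $\cot\theta$ defined). For $a\in\mathbb{R}_+$, $b\in\mathbb{R}$ and $\rho\ge 0$ put $$\phi^{\alpha}_{a,b}(t)=e^{-\frac{i}{2}(t^2-b^2)\cot\theta}\,|a|^{-\rho}\,\phi\!\left(\frac{t-b}{a}\right).$$ The general novel fractional wavelet transform (GNFrWT) of a function $h$ with respect to the wavelet $\phi$ is $$(W^\alpha_\phi h)(a,b)=\int_{\mathbb{R}}h(t)\,\overline{\phi^\alpha_{a,b}(t)}\,dt .$$ $\hat\phi$ denotes the Fourier transform of $\phi$, and $(h,g)=\int_{\mathbb{R}}h(t)\overline{g(t)}\,dt$ is the inner product of $L^2(\mathbb{R})$. *)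

theory Defs
  imports "HOL-Analysis.Analysis"
begin

definition L2 :: "(real \<Rightarrow> complex) \<Rightarrow> bool" where
  "L2 f \<longleftrightarrow> f \<in> borel_measurable lebesgue \<and> integrable lebesgue (\<lambda>t. (cmod (f t))\<^sup>2)"

definition L2_inner :: "(real \<Rightarrow> complex) \<Rightarrow> (real \<Rightarrow> complex) \<Rightarrow> complex" where
  "L2_inner h g = (LINT t|lebesgue. h t * cnj (g t))"

text \<open>
  The Fourier transform of a square-integrable function is the limit in the mean of the truncated
  integrals of \<open>\<phi>(t) exp(- i \<omega> t)\<close> over \<open>{-R..R}\<close>; it is determined up to a null set, and
  exists by Plancherel's theorem. There is no factor \<open>1 / sqrt (2 \<pi>)\<close> in front of the integral:
  this is the normalization for which the orthogonality relation of the wavelet transform holds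
  with the constant \<open>admissibility_const\<close> below and no extra factor \<open>2 \<pi>\<close>.
\<close>

definition is_L2_fourier :: "(real \<Rightarrow> complex) \<Rightarrow> (real \<Rightarrow> complex) \<Rightarrow> bool" where
  "is_L2_fourier \<phi> F \<longleftrightarrow> L2 F \<and>
     ((\<lambda>R::real. \<integral>\<^sup>+ \<omega>. ennreal ((cmod (F \<omega> -
          (LINT t:{-R..R}|lebesgue. \<phi> t * exp (- \<i> * complex_of_real (\<omega> * t)))))\<^sup>2) \<partial>lebesgue)
       \<longlongrightarrow> 0) at_top"

definition L2_fourier :: "(real \<Rightarrow> complex) \<Rightarrow> real \<Rightarrow> complex" where
  "L2_fourier \<phi> = (SOME F. is_L2_fourier \<phi> F)"

definition admissibility_const :: "(real \<Rightarrow> complex) \<Rightarrow> real" where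
  "admissibility_const \<phi> = (LINT \<omega>|lebesgue. (cmod (L2_fourier \<phi> \<omega>))\<^sup>2 / \<bar>\<omega>\<bar>)"

text \<open>The integrability condition says that the (nonnegative) integral
  \<open>admissibility_const \<phi>\<close> is finite.\<close>

definition wavelet :: "(real \<Rightarrow> complex) \<Rightarrow> bool" where
  "wavelet \<phi> \<longleftrightarrow> L2 \<phi> \<and>
     integrable lebesgue (\<lambda>\<omega>. (cmod (L2_fourier \<phi> \<omega>))\<^sup>2 / \<bar>\<omega>\<bar>) \<and>
     0 < admissibility_const \<phi>"

text \<open>
  The scale \<open>a\<close> ranges over all reals, since the orthogonality relation integrates over both
  signs of \<open>a\<close>; the value at \<open>a = 0\<close> is irrelevant there.
\<close>

definition frac_wavelet ::
  "real \<Rightarrow> real \<Rightarrow> (real \<Rightarrow> complex) \<Rightarrow> real \<Rightarrow> real \<Rightarrow> real \<Rightarrow> complex" where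
  "frac_wavelet \<alpha> \<rho> \<phi> a b t =
     exp (- (\<i> / 2) * complex_of_real ((t\<^sup>2 - b\<^sup>2) * cot (\<alpha> * pi / 2)))
       * complex_of_real (\<bar>a\<bar> powr (- \<rho>)) * \<phi> ((t - b) / a)"

definition GNFrWT ::
  "real \<Rightarrow> real \<Rightarrow> (real \<Rightarrow> complex) \<Rightarrow> (real \<Rightarrow> complex) \<Rightarrow> real \<Rightarrow> real \<Rightarrow> complex" where
  "GNFrWT \<alpha> \<rho> \<phi> h a b = (LINT t|lebesgue. h t * cnj (frac_wavelet \<alpha> \<rho> \<phi> a b t))"

end

theory Submission
  imports Defs "HOL-Probability.Probability"
begin

text \<open>
  Absorbing the chirp \<open>exp (\<i> t\<^sup>2 cot \<theta> / 2)\<close> into \<open>h\<close> and \<open>g\<close> turns the fractional transform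
  into an ordinary wavelet transform, up to a unimodular factor in \<open>b\<close> that cancels in the product.
  Writing \<open>F\<close> for the Fourier transform and \<open>H\<close> for the chirped \<open>h\<close>, the coefficient at scale \<open>a\<close>
  is then, as a function of \<open>b\<close>, the inverse transform of \<open>F H(\<omega>)\<close> times the conjugate of
  \<open>\<bar>a\<bar> F \<phi>(a \<omega>)\<close>. Parseval's identity in \<open>b\<close>, Fubini, and the scale invariance of \<open>da / \<bar>a\<bar>\<close>
  pull out the admissibility constant, and Parseval's identity once more gives the inner product.

  Parseval's identity on \<open>L\<^sup>1 \<inter> L\<^sup>2\<close> comes from inserting the weight
  \<open>exp (- (\<omega> / \<sigma>)\<^sup>2 / 2)\<close>: letting \<open>\<sigma>\<close> tend to infinity gives Bessel's inequality in general and
  equality when one factor is continuous and bounded, and Bessel's inequality extends the equality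
  by density.
\<close>

section \<open>Square-integrable functions\<close>

text \<open>No inversion theorem enters. Parseval's identity for the chirped signal and the
  translated, dilated wavelet presents the coefficient as an ordinary \<open>fourier\<close>
  integral, taken at \<open>- b\<close>, of an integrable product
  \<open>X \<omega> * cnj (F (a * \<omega>))\<close>. Parseval's identity can then be applied a
  second time, now in \<open>b\<close>, provided that this product is also square integrable.
  Admissibility of the wavelet yields this for almost every \<open>a\<close>.

  The exponents balance as follows: normalization and weight leave
  \<open>1 / \<bar>a\<bar> ^ 3\<close>, Parseval in \<open>b\<close> contributes
  \<open>\<bar>a\<bar>\<^sup>2 / (2 * pi)\<close>, and the result is the scale-invariant
  \<open>1 / \<bar>a\<bar>\<close> with a factor \<open>1 / (2 * pi)\<close> that the last use of
  Parseval cancels.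

  The Gaussian weight is needed because the transform of an integrable function is at first only
  known to be bounded: without the weight the exchange of integrals has no justification.

  Lebesgue-measurable data, and \<open>L2_fourier\<close>, which is known only through a choice, are
  replaced by Borel functions equal to them almost everywhere, so that Fubini and substitution can
  be carried out over \<open>lborel\<close>.\<close>

definition square_integrable :: "'a measure \<Rightarrow> ('a \<Rightarrow> complex) \<Rightarrow> bool" where
  "square_integrable M f \<longleftrightarrow> f \<in> borel_measurable M \<and> integrable M (\<lambda>x. (cmod (f x))\<^sup>2)"

abbreviation sq_norm :: "'a measure \<Rightarrow> ('a \<Rightarrow> complex) \<Rightarrow> real" where
  "sq_norm M f \<equiv> LINT x|M. (cmod (f x))\<^sup>2"

lemma borel_measurable_cnj [measurable]: "cnj \<in> borel_measurable borel"
  by (intro borel_measurable_continuous_onI continuous_intros)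

lemma sum_power2_le: "(a + b)\<^sup>2 \<le> 2 * a\<^sup>2 + 2 * (b::real)\<^sup>2"
  using sum_squares_bound[of a b] by (simp add: power2_sum)

lemma norm_diff_power2_le: "(cmod (a - b))\<^sup>2 \<le> 2 * (cmod a)\<^sup>2 + 2 * (cmod b)\<^sup>2"
proof -
  have "(cmod (a - b))\<^sup>2 \<le> (cmod a + cmod b)\<^sup>2"
    by (intro power_mono norm_triangle_ineq4) auto
  then show ?thesis
    using sum_power2_le[of "cmod a" "cmod b"] by linarith
qed

lemma square_integrable_bound:
  assumes "integrable M w" "f \<in> borel_measurable M" "\<And>x. (cmod (f x))\<^sup>2 \<le> w x"
  shows "square_integrable M f"
  unfolding square_integrable_def
proof (intro conjI Bochner_Integration.integrable_bound[OF assms(1)] assms(2))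
  show "(\<lambda>x. (cmod (f x))\<^sup>2) \<in> borel_measurable M"
    using assms(2) by measurable
  show "AE x in M. norm ((cmod (f x))\<^sup>2) \<le> norm (w x)"
    using assms(3) by (intro AE_I2) (metis abs_of_nonneg order_trans real_norm_def zero_le_power2)
qed

lemma square_integrable_diff:
  assumes "square_integrable M f" "square_integrable M g"
  shows "square_integrable M (\<lambda>x. f x - g x)"
  using assms
  by (intro square_integrable_bound[of M "\<lambda>x. 2 * (cmod (f x))\<^sup>2 + 2 * (cmod (g x))\<^sup>2"])
     (auto simp: square_integrable_def norm_diff_power2_le)

text \<open>Takes the place of the triangle inequality. The factors 2 are the price of staying with
  squared norms, and they do no harm in limit arguments.\<close>

lemma sq_norm_diff_le:
  assumes "square_integrable M f" "square_integrable M g" "square_integrable M h"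
  shows "sq_norm M (\<lambda>x. f x - h x) \<le> 2 * sq_norm M (\<lambda>x. f x - g x) + 2 * sq_norm M (\<lambda>x. g x - h x)"
proof -
  note fg = square_integrable_diff[OF assms(1,2)] and gh = square_integrable_diff[OF assms(2,3)]
    and fh = square_integrable_diff[OF assms(1,3)]
  have "sq_norm M (\<lambda>x. f x - h x) \<le> (LINT x|M. 2 * (cmod (f x - g x))\<^sup>2 + 2 * (cmod (g x - h x))\<^sup>2)"
  proof (rule integral_mono)
    show "(cmod (f x - h x))\<^sup>2 \<le> 2 * (cmod (f x - g x))\<^sup>2 + 2 * (cmod (g x - h x))\<^sup>2" for x
      using norm_diff_power2_le[of "f x - g x" "h x - g x"] by (simp add: norm_minus_commute)
  qed (use fg gh fh in \<open>auto simp: square_integrable_def\<close>)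
  also have "\<dots> = 2 * sq_norm M (\<lambda>x. f x - g x) + 2 * sq_norm M (\<lambda>x. g x - h x)"
    using fg gh by (simp add: square_integrable_def)
  finally show ?thesis .
qed

lemma nn_integral_sq_norm:
  "square_integrable M f \<Longrightarrow> (\<integral>\<^sup>+x. ennreal ((cmod (f x))\<^sup>2) \<partial>M) = ennreal (sq_norm M f)"
  by (intro nn_integral_eq_integral) (auto simp: square_integrable_def)

lemma square_integrable_cmult:
  assumes "square_integrable M f" "c \<in> borel_measurable M" "\<And>x. cmod (c x) \<le> B"
  shows "square_integrable M (\<lambda>x. c x * f x)"
proof (intro square_integrable_bound[of M "\<lambda>x. B\<^sup>2 * (cmod (f x))\<^sup>2"])
  show "(cmod (c x * f x))\<^sup>2 \<le> B\<^sup>2 * (cmod (f x))\<^sup>2" for x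
    unfolding norm_mult power_mult_distrib
    by (intro mult_right_mono power_mono assms(3)) auto
qed (use assms in \<open>auto simp: square_integrable_def\<close>)

lemma square_integrable_integrable_mult:
  assumes "square_integrable M f" "square_integrable M g"
  shows "integrable M (\<lambda>x. f x * cnj (g x))"
proof (rule Bochner_Integration.integrable_bound)
  show "integrable M (\<lambda>x. (cmod (f x))\<^sup>2 + (cmod (g x))\<^sup>2)"
    using assms by (auto simp: square_integrable_def)
  have [measurable]: "f \<in> borel_measurable M" "g \<in> borel_measurable M"
    using assms by (auto simp: square_integrable_def)
  show "(\<lambda>x. f x * cnj (g x)) \<in> borel_measurable M"
    by measurable
  have "cmod a * cmod b \<le> (cmod a)\<^sup>2 + (cmod b)\<^sup>2" for a b
  proof -
    have "0 \<le> cmod a * cmod b" by simp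
    moreover have "2 * (cmod a * cmod b) \<le> (cmod a)\<^sup>2 + (cmod b)\<^sup>2"
      using sum_squares_bound[of "cmod a" "cmod b"] by (simp add: mult.assoc)
    ultimately show ?thesis by linarith
  qed
  then show "AE x in M. cmod (f x * cnj (g x)) \<le> norm ((cmod (f x))\<^sup>2 + (cmod (g x))\<^sup>2)"
    by (auto simp: norm_mult)
qed

text \<open>Derived from the inequality for extended nonnegative integrals; integrability of the
  product allows it to be read back in the reals.\<close>

lemma Cauchy_Schwarz_integral:
  assumes f: "square_integrable M f" and g: "square_integrable M g"
  shows "cmod (LINT x|M. f x * cnj (g x)) \<le> sqrt (sq_norm M f) * sqrt (sq_norm M g)"
proof -
  have [measurable]: "f \<in> borel_measurable M" "g \<in> borel_measurable M"
    using assms by (auto simp: square_integrable_def)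
  have int: "integrable M (\<lambda>x. cmod (f x) * cmod (g x))"
    using integrable_norm[OF square_integrable_integrable_mult[OF f g]] by (simp add: norm_mult)
  have "ennreal ((LINT x|M. cmod (f x) * cmod (g x))\<^sup>2)
      = (\<integral>\<^sup>+x. ennreal (cmod (f x)) * ennreal (cmod (g x)) \<partial>M)\<^sup>2"
    using int by (simp add: nn_integral_eq_integral ennreal_power flip: ennreal_mult)
  also have "\<dots> \<le> (\<integral>\<^sup>+x. (ennreal (cmod (f x)))\<^sup>2 \<partial>M) * (\<integral>\<^sup>+x. (ennreal (cmod (g x)))\<^sup>2 \<partial>M)"
    by (rule Cauchy_Schwarz_nn_integral) measurable
  also have "\<dots> = ennreal (sq_norm M f * sq_norm M g)"
    using assms by (simp add: ennreal_power nn_integral_eq_integral square_integrable_def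
        ennreal_mult)
  finally have "(LINT x|M. cmod (f x) * cmod (g x))\<^sup>2 \<le> sq_norm M f * sq_norm M g"
    by (subst (asm) ennreal_le_iff) auto
  then have "LINT x|M. cmod (f x) * cmod (g x) \<le> sqrt (sq_norm M f) * sqrt (sq_norm M g)"
    by (simp add: real_le_rsqrt flip: real_sqrt_mult)
  moreover have "cmod (LINT x|M. f x * cnj (g x)) \<le> (LINT x|M. cmod (f x) * cmod (g x))"
    using integral_norm_bound[of M "\<lambda>x. f x * cnj (g x)"] by (simp add: norm_mult)
  ultimately show ?thesis by linarith
qed

section \<open>Continuity of the inner product\<close>

lemma tendsto_inner_left:
  assumes f: "\<And>n. square_integrable M (f n)" "square_integrable M f'"
    and g: "square_integrable M g"
    and lim: "((\<lambda>n. sq_norm M (\<lambda>x. f n x - f' x)) \<longlongrightarrow> 0) F"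
  shows "((\<lambda>n. LINT x|M. f n x * cnj (g x)) \<longlongrightarrow> (LINT x|M. f' x * cnj (g x))) F"
proof (rule Lim_null[THEN iffD2], rule Lim_null_comparison)
  show "\<forall>\<^sub>F n in F. norm ((LINT x|M. f n x * cnj (g x)) - (LINT x|M. f' x * cnj (g x)))
      \<le> sqrt (sq_norm M (\<lambda>x. f n x - f' x)) * sqrt (sq_norm M g)"
  proof (intro always_eventually allI)
    fix n
    have "(LINT x|M. f n x * cnj (g x)) - (LINT x|M. f' x * cnj (g x))
        = (LINT x|M. (f n x - f' x) * cnj (g x))"
      using f g by (simp add: square_integrable_integrable_mult left_diff_distrib)
    then show "norm ((LINT x|M. f n x * cnj (g x)) - (LINT x|M. f' x * cnj (g x)))
      \<le> sqrt (sq_norm M (\<lambda>x. f n x - f' x)) * sqrt (sq_norm M g)"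
      using Cauchy_Schwarz_integral[OF square_integrable_diff[OF f(1)[of n] f(2)] g] by simp
  qed
  show "((\<lambda>n. sqrt (sq_norm M (\<lambda>x. f n x - f' x)) * sqrt (sq_norm M g)) \<longlongrightarrow> 0) F"
    using tendsto_mult_left_zero[OF tendsto_real_sqrt[OF lim, simplified]] .
qed

lemma cnj_inner: "cnj (LINT x|M. g x * cnj (f x)) = (LINT x|M. f x * cnj (g x))"
proof -
  have "cnj (LINT x|M. g x * cnj (f x)) = (LINT x|M. cnj (g x * cnj (f x)))"
    by (rule Bochner_Integration.integral_cnj[symmetric])
  then show ?thesis by (simp only: complex_cnj_mult complex_cnj_cnj mult.commute)
qed

lemma tendsto_inner:
  assumes f: "\<And>n. square_integrable M (f n)" "square_integrable M f'"
    and g: "\<And>n. square_integrable M (g n)" "square_integrable M g'"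
    and limf: "((\<lambda>n. sq_norm M (\<lambda>x. f n x - f' x)) \<longlongrightarrow> 0) F"
    and limg: "((\<lambda>n. sq_norm M (\<lambda>x. g n x - g' x)) \<longlongrightarrow> 0) F"
  shows "((\<lambda>n. LINT x|M. f n x * cnj (g n x)) \<longlongrightarrow> (LINT x|M. f' x * cnj (g' x))) F"
proof -
  let ?d = "\<lambda>n x. f n x - f' x" and ?e = "\<lambda>n x. g n x - g' x"
  note d = square_integrable_diff[OF f(1) f(2)] and e = square_integrable_diff[OF g(1) g(2)]
  \<comment> \<open>Expanding the product of the two errors isolates a term that is small by
    Cauchy-Schwarz and leaves terms in which at most one factor varies. No uniform bound on the
    norms of \<open>f n\<close> or \<open>g n\<close> has to be found.\<close>
  have eq: "(LINT x|M. f n x * cnj (g n x)) = (LINT x|M. ?d n x * cnj (?e n x))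
      + (LINT x|M. f n x * cnj (g' x)) + (LINT x|M. f' x * cnj (g n x)) - (LINT x|M. f' x * cnj
          (g' x))" for n
  proof -
    have "(LINT x|M. f n x * cnj (g n x)) = (LINT x|M. ?d n x * cnj (?e n x)
      + f n x * cnj (g' x) + f' x * cnj (g n x) - f' x * cnj (g' x))"
      by (simp add: algebra_simps)
    also have "\<dots> = (LINT x|M. ?d n x * cnj (?e n x))
      + (LINT x|M. f n x * cnj (g' x)) + (LINT x|M. f' x * cnj (g n x)) - (LINT x|M. f' x * cnj
          (g' x))"
      by (subst Bochner_Integration.integral_diff Bochner_Integration.integral_add;
          (intro Bochner_Integration.integrable_add square_integrable_integrable_mult f g d e)?)+
              (rule refl)
    finally show ?thesis .
  qed
  have small: "((\<lambda>n. LINT x|M. ?d n x * cnj (?e n x)) \<longlongrightarrow> 0) F"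
  proof (rule Lim_null_comparison[OF always_eventually])
    show "\<forall>n. cmod (LINT x|M. ?d n x * cnj (?e n x))
        \<le> sqrt (sq_norm M (?d n)) * sqrt (sq_norm M (?e n))"
      using Cauchy_Schwarz_integral[OF d e] by blast
    show "((\<lambda>n. sqrt (sq_norm M (?d n)) * sqrt (sq_norm M (?e n))) \<longlongrightarrow> 0) F"
      using tendsto_mult[OF tendsto_real_sqrt[OF limf] tendsto_real_sqrt[OF limg]] by simp
  qed
  have "((\<lambda>n. LINT x|M. f' x * cnj (g n x)) \<longlongrightarrow> (LINT x|M. f' x * cnj (g' x))) F"
    using tendsto_cnj[OF tendsto_inner_left[OF g f(2) limg]] by (simp only: cnj_inner)
  then have "((\<lambda>n. LINT x|M. f n x * cnj (g n x)) \<longlongrightarrow> 0 + (LINT x|M. f' x * cnj (g' x))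
     + (LINT x|M. f' x * cnj (g' x)) - (LINT x|M. f' x * cnj (g' x))) F"
    unfolding eq
    by (intro tendsto_add tendsto_diff tendsto_const small tendsto_inner_left f g limf)
  then show ?thesis by (simp only: add_0 add_diff_cancel)
qed

section \<open>Completeness of the space of square-integrable functions (Riesz-Fischer)\<close>

lemma square_integrable_nn_integralI:
  assumes [measurable]: "f \<in> borel_measurable M"
      and le: "(\<integral>\<^sup>+x. ennreal ((cmod (f x))\<^sup>2) \<partial>M) \<le> ennreal C"
    and "C \<ge> 0"
  shows "square_integrable M f" "sq_norm M f \<le> C"
proof -
  show sq: "square_integrable M f"
    unfolding square_integrable_def
  proof
    show "integrable M (\<lambda>x. (cmod (f x))\<^sup>2)"
      using le by (intro integrableI_bounded) (auto intro: le_less_trans)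
  qed measurable
  show "sq_norm M f \<le> C"
    using le unfolding nn_integral_sq_norm[OF sq] using assms(3)
        by (subst (asm) ennreal_le_iff) auto
qed

lemma AE_convergent_of_geometric_increments:
  assumes v: "\<And>k. square_integrable M (v k)"
    and le: "\<And>k. sq_norm M (\<lambda>x. v (Suc k) x - v k x) \<le> (1 / 8) ^ k"
  shows "AE x in M. convergent (\<lambda>k. v k x)"
proof -
  have [measurable]: "v k \<in> borel_measurable M" for k
    using v by (auto simp: square_integrable_def)
  \<comment> \<open>The weight \<open>2 ^ k\<close> is small enough that the integrals still decay
    like \<open>(1 / 4) ^ k\<close>, and large enough that pointwise summability of
    \<open>?d\<close> controls the unsquared increments.\<close>
  let ?d = "\<lambda>k x. 2 ^ k * (cmod (v (Suc k) x - v k x))\<^sup>2"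
  have "(\<integral>\<^sup>+x. (\<Sum>k. ennreal (?d k x)) \<partial>M) = (\<Sum>k. \<integral>\<^sup>+x. ennreal (?d k x) \<partial>M)"
    by (rule nn_integral_suminf) measurable
  also have "\<dots> \<le> (\<Sum>k. ennreal ((1 / 4) ^ k))"
  proof (intro suminf_le summableI allI)
    fix k
    have "(\<integral>\<^sup>+x. ennreal (?d k x) \<partial>M) = ennreal (2 ^ k) * (\<integral>\<^sup>+x. ennreal ((cmod (v (Suc k) x
        - v k x))\<^sup>2) \<partial>M)"
      by (simp add: ennreal_mult nn_integral_cmult)
    also have "\<dots> = ennreal (2 ^ k * sq_norm M (\<lambda>x. v (Suc k) x - v k x))"
      by (subst nn_integral_sq_norm[OF square_integrable_diff[OF v v]]) (simp add: ennreal_mult)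
    also have "\<dots> \<le> ennreal (2 ^ k * (1 / 8) ^ k)"
      by (intro ennreal_leI mult_left_mono le) auto
    also have "2 ^ k * (1 / 8) ^ k = (1 / 4 :: real) ^ k"
      by (simp flip: power_mult_distrib)
    finally show "(\<integral>\<^sup>+x. ennreal (?d k x) \<partial>M) \<le> ennreal ((1 / 4) ^ k)" .
  qed
  also have "\<dots> = ennreal (\<Sum>k. (1 / 4) ^ k)"
    by (intro suminf_ennreal2) (auto intro: summable_geometric)
  also have "\<dots> < \<infinity>" by simp
  finally have "(\<integral>\<^sup>+x. (\<Sum>k. ennreal (?d k x)) \<partial>M) \<noteq> \<infinity>" by simp
  then have "AE x in M. (\<Sum>k. ennreal (?d k x)) \<noteq> \<infinity>"
    by (intro nn_integral_PInf_AE) measurable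
  then show ?thesis
  proof eventually_elim
    case (elim x)
    then have "summable (\<lambda>k. ?d k x)"
      by (intro summable_suminf_not_top) auto
    then have "summable (\<lambda>k. (1 / 2) ^ k + ?d k x)"
      by (intro summable_add summable_geometric) auto
    then have "summable (\<lambda>k. v (Suc k) x - v k x)"
    proof (rule summable_comparison_test')
      fix k
      let ?z = "cmod (v (Suc k) x - v k x)"
      \<comment> \<open>Arithmetic-geometric mean inequality: twice the increment is at most
        \<open>(1 / 2) ^ k + ?d k x\<close>, a summable sequence.\<close>
      have "0 \<le> (1 - 2 ^ k * ?z)\<^sup>2 / 2 ^ k" by simp
      also have "\<dots> = (1 / 2) ^ k + 2 ^ k * ?z\<^sup>2 - 2 * ?z"
        by (simp add: power2_eq_square field_simps power_one_over)
      finally show "?z \<le> (1 / 2) ^ k + ?d k x"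
        using norm_ge_zero[of "v (Suc k) x - v k x"] by linarith
    qed
    then have "(\<lambda>n. \<Sum>k<n. v (Suc k) x - v k x) \<longlonglongrightarrow> (\<Sum>k. v (Suc k) x - v k x)"
      by (rule summable_LIMSEQ)
    then have "(\<lambda>n. v n x - v 0 x) \<longlonglongrightarrow> (\<Sum>k. v (Suc k) x - v k x)"
      unfolding sum_lessThan_telescope[of "\<lambda>k. v k x"] .
    then have "(\<lambda>n. (v n x - v 0 x) + v 0 x) \<longlonglongrightarrow> (\<Sum>k. v (Suc k) x - v k x) + v 0 x"
      by (intro tendsto_add tendsto_const)
    then show ?case
      by (auto simp: convergent_def)
  qed
qed

theorem square_integrable_complete:
  assumes u: "\<And>n. square_integrable M (u n)"
    and Cauchy: "\<And>e. e > 0 \<Longrightarrow> \<exists>N. \<forall>m\<ge>N. \<forall>n\<ge>N. sq_norm M (\<lambda>x. u m x - u n x) < (e::real)"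
  obtains F where "square_integrable M F" "(\<lambda>n::nat. sq_norm M (\<lambda>x. u n x - F x)) \<longlonglongrightarrow> 0"
proof -
  have [measurable]: "u n \<in> borel_measurable M" for n
    using u by (auto simp: square_integrable_def)
  have "\<forall>k. \<exists>N. \<forall>m\<ge>N. \<forall>n\<ge>N. sq_norm M (\<lambda>x. u m x - u n x) < (1 / 8) ^ k"
    by (intro allI Cauchy) simp
  from choice[OF this] obtain N
    where N: "\<And>k m n. m \<ge> N k \<Longrightarrow> n \<ge> N k \<Longrightarrow> sq_norm M (\<lambda>x. u m x - u n x) < (1 / 8) ^ k"
    by blast
  \<comment> \<open>The sum makes index \<open>r k\<close> and its successor
    \<open>r (Suc k)\<close> both at least \<open>N k\<close>, as the increment estimate requires;
    the summand \<open>k\<close> makes the subsequence tend to infinity.\<close>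
  define r where "r = (\<lambda>k. k + (\<Sum>i\<le>k. N i))"
  have r: "N k \<le> r k" "N k \<le> r (Suc k)" "k \<le> r k" for k
    unfolding r_def by (auto simp: lessThan_Suc_atMost[symmetric] intro: trans_le_add2)
  \<comment> \<open>Taking \<open>lim\<close> at every point gives measurability at once; its value
    where the subsequence diverges matters only on a null set.\<close>
  define F where "F = (\<lambda>x. lim (\<lambda>k. u (r k) x))"
  have [measurable]: "F \<in> borel_measurable M"
    unfolding F_def by measurable
  have "AE x in M. convergent (\<lambda>k. u (r k) x)"
    by (rule AE_convergent_of_geometric_increments) (auto intro!: u less_imp_le N r)
  then have conv: "AE x in M. (\<lambda>k. u (r k) x) \<longlonglongrightarrow> F x"
    unfolding F_def by eventually_elim (simp add: convergent_LIMSEQ_iff)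
  have bound: "(\<integral>\<^sup>+x. ennreal ((cmod (u n x - F x))\<^sup>2) \<partial>M) \<le> ennreal e"
    if n: "n \<ge> K" and K: "\<And>m n. m \<ge> K \<Longrightarrow> n \<ge> K \<Longrightarrow> sq_norm M (\<lambda>x. u m x - u n x) < e" for K n e
  proof -
    \<comment> \<open>Preparation for Fatou's lemma: the Cauchy bound between \<open>u n\<close> and
      \<open>u (r k)\<close> passes to the limit in \<open>k\<close>.\<close>
    have "AE x in M. ennreal ((cmod (u n x - F x))\<^sup>2)
        = liminf (\<lambda>k. ennreal ((cmod (u n x - u (r k) x))\<^sup>2))"
      using conv
    proof eventually_elim
      case (elim x)
      have "(\<lambda>k. ennreal ((cmod (u n x - u (r k) x))\<^sup>2)) \<longlonglongrightarrow> ennreal ((cmod (u n x - F x))\<^sup>2)"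
        by (intro tendsto_intros tendsto_ennrealI elim)
      then show ?case
        by (intro lim_imp_Liminf[symmetric]) auto
    qed
    then have "(\<integral>\<^sup>+x. ennreal ((cmod (u n x - F x))\<^sup>2) \<partial>M)
       = (\<integral>\<^sup>+x. liminf (\<lambda>k. ennreal ((cmod (u n x - u (r k) x))\<^sup>2)) \<partial>M)"
      by (rule nn_integral_cong_AE)
    also have "\<dots> \<le> liminf (\<lambda>k. \<integral>\<^sup>+x. ennreal ((cmod (u n x - u (r k) x))\<^sup>2) \<partial>M)"
      by (rule nn_integral_liminf) measurable
    also have "\<dots> \<le> liminf (\<lambda>k::nat. ennreal e)"
    proof (rule Liminf_mono)
      show "\<forall>\<^sub>F k in sequentially. (\<integral>\<^sup>+x. ennreal ((cmod (u n x - u (r k) x))\<^sup>2) \<partial>M) \<le> ennreal e"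
        using eventually_ge_at_top[of K]
      proof eventually_elim
        case (elim k)
        then have "r k \<ge> K" using r(3)[of k] by linarith
        then show ?case
          using K[OF n, of "r k"]
          by (subst nn_integral_sq_norm[OF square_integrable_diff[OF u u]])
              (auto intro!: ennreal_leI)
      qed
    qed
    also have "\<dots> = ennreal e"
      by (simp add: Liminf_const)
    finally show ?thesis .
  qed
  have ex: "\<exists>K. \<forall>n\<ge>K. square_integrable M (\<lambda>x. u n x - F x) \<and> sq_norm M (\<lambda>x. u n x - F x) \<le> e"
      if pos: "e > 0" for e
  proof -
    obtain K where K: "\<And>m n. m \<ge> K \<Longrightarrow> n \<ge> K \<Longrightarrow> sq_norm M (\<lambda>x. u m x - u n x) < e"
      using Cauchy[OF pos] by blast
    have "square_integrable M (\<lambda>x. u n x - F x) \<and> sq_norm M (\<lambda>x. u n x - F x) \<le> e" if "n \<ge> K" for n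
      using square_integrable_nn_integralI[OF _ bound[OF that K]] \<open>e > 0\<close> by simp
    then show ?thesis by blast
  qed
  obtain n where "square_integrable M (\<lambda>x. u n x - F x)"
    using ex[of 1] by auto
  then have F: "square_integrable M F"
    using square_integrable_diff[OF u[of n], of "\<lambda>x. u n x - F x"] by simp
  moreover have "(\<lambda>n. sq_norm M (\<lambda>x. u n x - F x)) \<longlonglongrightarrow> 0"
  proof (rule LIMSEQ_I)
    fix e :: real assume "e > 0"
    then obtain K where "\<forall>n\<ge>K. sq_norm M (\<lambda>x. u n x - F x) \<le> e / 2"
      using ex[of "e / 2"] by auto
    then have "\<forall>n\<ge>K. norm (sq_norm M (\<lambda>x. u n x - F x) - 0) < e"
      using \<open>e > 0\<close> by (auto intro: le_less_trans)
    then show "\<exists>no. \<forall>n\<ge>no. norm (sq_norm M (\<lambda>x. u n x - F x) - 0) < e"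
      by blast
  qed
  ultimately show ?thesis by (rule that)
qed

text \<open>Dominated convergence with \<open>(cmod (f x))\<^sup>2\<close> as the bound. The
  condition on \<open>A\<close> covers growing intervals as well as sets on which \<open>f\<close>
  itself is bounded.\<close>

lemma square_integrable_cutoff:
  assumes f: "square_integrable M f" and A: "\<And>n. A n \<in> sets M"
    and ev: "\<And>x. x \<in> space M \<Longrightarrow> \<forall>\<^sub>F n in sequentially. x \<in> A n"
  shows "(\<lambda>n. sq_norm M (\<lambda>x. f x - indicator (A n) x * f x)) \<longlonglongrightarrow> 0"
proof -
  have [measurable]: "f \<in> borel_measurable M" "\<And>n. A n \<in> sets M"
    using f A by (auto simp: square_integrable_def)
  have "(\<lambda>n. sq_norm M (\<lambda>x. f x - indicator (A n) x * f x)) \<longlonglongrightarrow> (LINT x|M. 0)"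
  proof (rule integral_dominated_convergence)
    show "integrable M (\<lambda>x. (cmod (f x))\<^sup>2)"
      using f by (simp add: square_integrable_def)
    show "AE x in M. (\<lambda>n. (cmod (f x - indicator (A n) x * f x))\<^sup>2) \<longlonglongrightarrow> 0"
    proof (rule AE_I2)
      fix x assume "x \<in> space M"
      then have "\<forall>\<^sub>F n in sequentially. (cmod (f x - indicator (A n) x * f x))\<^sup>2 = 0"
        by (rule eventually_mono[OF ev]) simp
      then show "(\<lambda>n. (cmod (f x - indicator (A n) x * f x))\<^sup>2) \<longlonglongrightarrow> 0"
        by (rule tendsto_eventually)
    qed
    show "AE x in M. norm ((cmod (f x - indicator (A n) x * f x))\<^sup>2) \<le> (cmod (f x))\<^sup>2" for n
      by (auto simp: indicator_def)
  qed measurable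
  then show ?thesis by simp
qed

section \<open>The Fourier transform of integrable functions\<close>

text \<open>The pointwise integral with the normalization of \<open>is_L2_fourier\<close>; without a
  prefactor, Parseval's identity carries the constant \<open>2 * pi\<close>.\<close>

definition fourier :: "(real \<Rightarrow> complex) \<Rightarrow> real \<Rightarrow> complex" where
  "fourier f \<omega> = (LINT t|lborel. f t * exp (- \<i> * complex_of_real (\<omega> * t)))"

lemma norm_exp_imaginary [simp]:
  "cmod (exp (- (\<i> * complex_of_real x))) = 1" "cmod (exp (\<i> * complex_of_real x)) = 1"
  by (simp_all add: norm_exp_eq_Re)

lemma integrable_fourier_kernel:
  assumes "integrable lborel f"
  shows "integrable lborel (\<lambda>t. f t * exp (- \<i> * complex_of_real (\<omega> * t)))"
  using assms
proof (rule Bochner_Integration.integrable_bound)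
  have [measurable]: "f \<in> borel_measurable borel"
    using assms by (auto dest: borel_measurable_integrable)
  show "(\<lambda>t. f t * exp (- \<i> * complex_of_real (\<omega> * t))) \<in> borel_measurable lborel"
    by measurable
qed (simp add: norm_mult)

lemma norm_fourier_le: "cmod (fourier f \<omega>) \<le> (LINT t|lborel. cmod (f t))"
  using integral_norm_bound[of lborel "\<lambda>t. f t * exp (- \<i> * complex_of_real (\<omega> * t))"]
  by (simp add: fourier_def norm_mult)

lemma borel_measurable_fourier [measurable]:
  assumes [measurable]: "f \<in> borel_measurable borel"
  shows "fourier f \<in> borel_measurable borel"
  unfolding fourier_def[abs_def]
  by (rule lborel.borel_measurable_lebesgue_integral) measurable

lemma fourier_diff:
  assumes "integrable lborel f" "integrable lborel g"
  shows "fourier (\<lambda>t. f t - g t) \<omega> = fourier f \<omega> - fourier g \<omega>"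
  unfolding fourier_def left_diff_distrib
  by (rule Bochner_Integration.integral_diff) (intro integrable_fourier_kernel assms)+

lemma integrable_fourier_mult:
  assumes "integrable lborel f" "integrable lborel q"
  shows "integrable lborel (\<lambda>\<omega>. fourier f \<omega> * q \<omega>)"
proof (rule Bochner_Integration.integrable_bound)
  show "integrable lborel (\<lambda>\<omega>. (LINT t|lborel. cmod (f t)) * cmod (q \<omega>))"
    using assms by auto
  have [measurable]: "f \<in> borel_measurable borel" "q \<in> borel_measurable borel"
    using assms by (auto dest: borel_measurable_integrable)
  show "(\<lambda>\<omega>. fourier f \<omega> * q \<omega>) \<in> borel_measurable lborel"
    by measurable
  show "AE x in lborel. cmod (fourier f x * q x) \<le> norm ((LINT t|lborel. cmod (f t)) * cmod (q x))"
    by (auto simp: norm_mult intro!: mult_right_mono norm_fourier_le)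
qed

text \<open>Fubini: \<open>f t * q \<omega>\<close> times a unimodular kernel is absolutely
  integrable on the plane. The transform thereby moves from one factor to the other.\<close>

lemma fourier_multiplication_formula:
  assumes f: "integrable lborel f" and q: "integrable lborel q"
  shows "(LINT \<omega>|lborel. fourier f \<omega> * q \<omega>) = (LINT t|lborel. f t * fourier q t)"
proof -
  have [measurable]: "f \<in> borel_measurable borel" "q \<in> borel_measurable borel"
    using assms by (auto dest: borel_measurable_integrable)
  let ?k = "\<lambda>t \<omega>. f t * q \<omega> * exp (- \<i> * complex_of_real (\<omega> * t))"
  have "integrable (lborel \<Otimes>\<^sub>M lborel) (case_prod ?k)"
  proof (rule lborel_pair.Fubini_integrable)
    show "integrable lborel (\<lambda>x. LINT y|lborel. norm (case_prod ?k (x, y)))"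
      using f q by (simp add: norm_mult)
    have "integrable lborel (?k x)" for x
      using integrable_mult_right[OF integrable_fourier_kernel[OF q, of x], of "f x"]
      by (simp add: mult_ac)
    then show "AE x in lborel. integrable lborel (\<lambda>y. case_prod ?k (x, y))"
      by simp
  qed measurable
  then have "(LINT \<omega>|lborel. LINT t|lborel. ?k t \<omega>) = (LINT t|lborel. LINT \<omega>|lborel. ?k t \<omega>)"
    by (rule lborel_pair.Fubini_integral)
  moreover have "(LINT t|lborel. ?k t \<omega>) = fourier f \<omega> * q \<omega>" for \<omega>
  proof -
    have "(LINT t|lborel. ?k t \<omega>) = (LINT t|lborel. f t * exp (- \<i> * complex_of_real (\<omega> * t))
        * q \<omega>)"
      by (simp add: mult_ac)
    then show ?thesis by (simp add: fourier_def)
  qed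
  moreover have "(LINT \<omega>|lborel. ?k t \<omega>) = f t * fourier q t" for t
    by (simp add: fourier_def mult.assoc mult.commute[of t])
  ultimately show ?thesis by simp
qed

section \<open>Gaussian regularization and Bessel's inequality\<close>

lemma integrable_std_normal_density_affine:
  "\<sigma> \<noteq> 0 \<Longrightarrow> integrable lborel (\<lambda>x. std_normal_density (t + \<sigma> * x))"
  by (rule lborel_integrable_real_affine) auto

text \<open>After the substitution \<open>\<omega> = \<sigma> * u\<close> this is the characteristic
  function of the standard normal distribution, at \<open>\<sigma> * (s - t)\<close>. The modulation
  by \<open>s\<close> is what later turns the Gaussian into a convolution kernel.\<close>

lemma fourier_gaussian:
  assumes "\<sigma> > 0"
  shows "fourier (\<lambda>\<omega>. exp (\<i> * complex_of_real (s * \<omega>)) * complex_of_real (std_normal_density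
      (\<omega> / \<sigma>))) t
    = complex_of_real (\<sigma> * exp (- (\<sigma> * (s - t))\<^sup>2 / 2))"
proof -
  have "fourier (\<lambda>\<omega>. exp (\<i> * complex_of_real (s * \<omega>)) * complex_of_real (std_normal_density
      (\<omega> / \<sigma>))) t
    = (LINT \<omega>|lborel. complex_of_real (std_normal_density (\<omega> / \<sigma>)) * exp (\<i> * complex_of_real ((s
        - t) * \<omega>)))"
    unfolding fourier_def
    by (intro Bochner_Integration.integral_cong refl)
        (simp add: mult_ac left_diff_distrib right_diff_distrib exp_diff exp_minus field_simps)
  also have "\<dots> = \<bar>\<sigma>\<bar> *\<^sub>R (LINT u|lborel. complex_of_real (std_normal_density ((0
      + \<sigma> * u) / \<sigma>)) * exp (\<i> * complex_of_real ((s - t) * (0 + \<sigma> * u))))"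
    using assms by (intro lborel_integral_real_affine) auto
  also have "\<dots> = \<sigma> * (LINT u|lborel. std_normal_density u *\<^sub>R exp (\<i> * complex_of_real ((\<sigma> * (s
      - t)) * u)))"
    using assms by (simp add: scaleR_conv_of_real mult_ac)
  also have "(LINT u|lborel. std_normal_density u *\<^sub>R exp (\<i> * complex_of_real ((\<sigma> * (s - t)) * u)))
    = char std_normal_distribution (\<sigma> * (s - t))"
    unfolding char_def by (subst integral_density) auto
  also have "\<dots> = complex_of_real (exp (- (\<sigma> * (s - t))\<^sup>2 / 2))"
    by (simp add: char_std_normal_distribution)
  finally show ?thesis by simp
qed

lemma std_normal_density_le: "std_normal_density x \<le> 1 / sqrt (2 * pi)"
  by (simp add: std_normal_density_def field_simps)

text \<open>The multiplication formula is used twice: for \<open>g\<close> against the modulated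
  Gaussian, which computes the transform of \<open>cnj (fourier g \<omega>)\<close> times the
  weight, and then for \<open>f\<close> against that product. The weight makes the product
  integrable.\<close>

lemma gaussian_regularization:
  assumes f: "integrable lborel f" and g: "integrable lborel g" and \<sigma>: "\<sigma> > 0"
  shows "(LINT \<omega>|lborel. fourier f \<omega> * cnj (fourier g \<omega>) * complex_of_real (std_normal_density
      (\<omega> / \<sigma>)))
    = (LINT s|lborel. f s * (LINT t|lborel. cnj (g t) * complex_of_real (\<sigma> * exp (- (\<sigma> * (s
        - t))\<^sup>2 / 2))))"
proof -
  let ?\<gamma> = "\<lambda>\<omega>. complex_of_real (std_normal_density (\<omega> / \<sigma>))"
  have [measurable]: "f \<in> borel_measurable borel" "g \<in> borel_measurable borel"
    using assms by (auto dest: borel_measurable_integrable)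
  have \<gamma>: "integrable lborel ?\<gamma>"
    using integrable_std_normal_density_affine[of "1/\<sigma>" 0] \<sigma> by simp
  have \<gamma>s: "integrable lborel (\<lambda>\<omega>. exp (\<i> * complex_of_real (s * \<omega>)) * ?\<gamma> \<omega>)" for s
    using \<gamma> by (rule Bochner_Integration.integrable_bound) (measurable, simp add: norm_mult)
  have "fourier (\<lambda>\<omega>. cnj (fourier g \<omega>) * ?\<gamma> \<omega>) s
      = (LINT t|lborel. cnj (g t) * complex_of_real (\<sigma> * exp (- (\<sigma> * (s - t))\<^sup>2 / 2)))" for s
  proof -
    have "fourier (\<lambda>\<omega>. cnj (fourier g \<omega>) * ?\<gamma> \<omega>) s
      = (LINT \<omega>|lborel. cnj (fourier g \<omega> * (exp (\<i> * complex_of_real (s * \<omega>)) * ?\<gamma> \<omega>)))"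
      unfolding fourier_def[of "\<lambda>\<omega>. cnj (fourier g \<omega>) * ?\<gamma> \<omega>"]
      by (intro Bochner_Integration.integral_cong refl) (simp add: exp_cnj mult_ac)
    also have "\<dots> = cnj (LINT \<omega>|lborel. fourier g \<omega> * (exp (\<i> * complex_of_real (s * \<omega>)) * ?\<gamma> \<omega>))"
      by (rule Bochner_Integration.integral_cnj)
    also have "\<dots> = cnj (LINT t|lborel. g t * complex_of_real (\<sigma> * exp (- (\<sigma> * (s - t))\<^sup>2 / 2)))"
      by (simp only: fourier_multiplication_formula[OF g \<gamma>s] fourier_gaussian[OF \<sigma>])
    also have "\<dots> = (LINT t|lborel. cnj (g t * complex_of_real (\<sigma> * exp (- (\<sigma> * (s - t))\<^sup>2 / 2))))"
      by (rule Bochner_Integration.integral_cnj[symmetric])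
    finally show ?thesis by (simp only: complex_cnj_mult complex_cnj_complex_of_real)
  qed
  moreover have "integrable lborel (\<lambda>\<omega>. cnj (fourier g \<omega>) * ?\<gamma> \<omega>)"
  proof (rule Bochner_Integration.integrable_bound[OF integrable_fourier_mult[OF g \<gamma>]])
    show "(\<lambda>\<omega>. cnj (fourier g \<omega>) * ?\<gamma> \<omega>) \<in> borel_measurable lborel"
      by measurable
  qed (simp add: norm_mult)
  ultimately show ?thesis
    using fourier_multiplication_formula[OF f, of "\<lambda>\<omega>. cnj (fourier g \<omega>) * ?\<gamma> \<omega>"]
    by (simp only: mult.assoc)
qed

text \<open>By scaling to the standard normal density. The mass is the same for every
  \<open>\<sigma>\<close>, so the kernel divided by \<open>sqrt (2 * pi)\<close> is an approximate
  identity as \<open>\<sigma>\<close> grows.\<close>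

lemma nn_integral_gaussian_kernel:
  assumes "\<sigma> > 0"
  shows "(\<integral>\<^sup>+t. ennreal (\<sigma> * exp (- (\<sigma> * (s - t))\<^sup>2 / 2)) \<partial>lborel) = ennreal (sqrt (2 * pi))"
proof -
  have "\<sigma> * exp (- (\<sigma> * (s - t))\<^sup>2 / 2) = sqrt (2 * pi) * (\<sigma> * std_normal_density (\<sigma> * s
      + (- \<sigma>) * t))" for t
    by (simp add: std_normal_density_def algebra_simps)
  then have "(\<integral>\<^sup>+t. ennreal (\<sigma> * exp (- (\<sigma> * (s - t))\<^sup>2 / 2)) \<partial>lborel)
     = ennreal (sqrt (2 * pi)) * (ennreal \<bar>- \<sigma>\<bar> * (\<integral>\<^sup>+t. ennreal (std_normal_density (\<sigma> * s
         + (- \<sigma>) * t)) \<partial>lborel))"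
    using assms by (simp add: ennreal_mult nn_integral_cmult mult.left_commute)
  also have "ennreal \<bar>- \<sigma>\<bar> * (\<integral>\<^sup>+t. ennreal (std_normal_density (\<sigma> * s + (- \<sigma>) * t)) \<partial>lborel)
     = (\<integral>\<^sup>+t. ennreal (std_normal_density t) \<partial>lborel)"
    using assms by (intro nn_integral_real_affine[symmetric]) auto
  also have "\<dots> = 1"
    by (subst nn_integral_eq_integral) auto
  finally show ?thesis by simp
qed

lemma nn_integral_gaussian_kernel':
  assumes "\<sigma> > 0"
  shows "(\<integral>\<^sup>+s. ennreal (\<sigma> * exp (- (\<sigma> * (s - t))\<^sup>2 / 2)) \<partial>lborel) = ennreal (sqrt (2 * pi))"
  using nn_integral_gaussian_kernel[OF assms, of t]
  by (simp add: power_mult_distrib power2_commute[of t])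

lemma integral_norm_bound_ennreal':
  fixes f :: "'a \<Rightarrow> complex"
  shows "ennreal (cmod (integral\<^sup>L M f)) \<le> (\<integral>\<^sup>+x. ennreal (cmod (f x)) \<partial>M)"
  by (cases "integrable M f") (auto simp: integral_norm_bound_ennreal not_integrable_integral_eq)

text \<open>A Schur test: \<open>cmod (f s) * cmod (f t)\<close> is split into half the sum of the
  squares, and in each half the kernel is integrated over the variable that the square does not
  contain. The bound is independent of \<open>\<sigma>\<close>, which prepares Fatou's
  lemma.\<close>

lemma nn_integral_fourier_gaussian_le:
  assumes f: "integrable lborel f" "square_integrable lborel f" and \<sigma>: "\<sigma> > 0"
  shows "(\<integral>\<^sup>+\<omega>. ennreal ((cmod (fourier f \<omega>))\<^sup>2 * std_normal_density (\<omega> / \<sigma>)) \<partial>lborel)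
    \<le> ennreal (sqrt (2 * pi) * sq_norm lborel f)"
proof -
  have [measurable]: "f \<in> borel_measurable borel"
    using f by (auto dest: borel_measurable_integrable)
  let ?k = "\<lambda>s t. \<sigma> * exp (- (\<sigma> * (s - t))\<^sup>2 / 2)"
  let ?w = "\<lambda>\<omega>. (cmod (fourier f \<omega>))\<^sup>2 * std_normal_density (\<omega> / \<sigma>)"
  let ?R = "LINT s|lborel. f s * (LINT t|lborel. cnj (f t) * complex_of_real (?k s t))"
  have sq: "(\<integral>\<^sup>+s. ennreal ((cmod (f s))\<^sup>2 / 2) \<partial>lborel) = ennreal (sq_norm lborel f / 2)"
    using f(2) by (subst nn_integral_eq_integral) (auto simp: square_integrable_def)
  have \<gamma>: "integrable lborel (\<lambda>\<omega>. complex_of_real (std_normal_density (\<omega> / \<sigma>)))"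
    using integrable_std_normal_density_affine[of "1/\<sigma>" 0] \<sigma> by simp
  have "integrable lborel ?w"
  proof (rule Bochner_Integration.integrable_bound)
    show "integrable lborel (\<lambda>\<omega>. (LINT t|lborel. cmod (f t))\<^sup>2 * std_normal_density (\<omega> / \<sigma>))"
      using integrable_std_normal_density_affine[of "1/\<sigma>" 0] \<sigma> by auto
    show "AE x in lborel. norm (?w x) \<le> norm ((LINT t|lborel. cmod (f t))\<^sup>2 * std_normal_density
        (x / \<sigma>))"
      by (auto simp: abs_mult intro!: mult_right_mono power_mono norm_fourier_le)
  qed measurable
  then have "(\<integral>\<^sup>+\<omega>. ennreal (?w \<omega>) \<partial>lborel) = ennreal (LINT \<omega>|lborel. ?w \<omega>)"
    by (intro nn_integral_eq_integral) auto
  also have "(LINT \<omega>|lborel. ?w \<omega>) = cmod (complex_of_real (LINT \<omega>|lborel. ?w \<omega>))"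
    by simp
  also have "complex_of_real (LINT \<omega>|lborel. ?w \<omega>) = ?R"
    by (simp only: integral_complex_of_real[symmetric] gaussian_regularization[OF f(1) f(1) \<sigma>,
        symmetric]
          of_real_mult[of "(cmod z)\<^sup>2" for z] complex_norm_square)
  also have "ennreal (cmod ?R)
      \<le> (\<integral>\<^sup>+s. ennreal (cmod (f s * (LINT t|lborel. cnj (f t) * complex_of_real
          (?k s t)))) \<partial>lborel)"
    by (rule integral_norm_bound_ennreal')
  also have "\<dots> \<le> (\<integral>\<^sup>+s. \<integral>\<^sup>+t. (ennreal ((cmod (f s))\<^sup>2 / 2) * ennreal (?k s t)
       + ennreal ((cmod (f t))\<^sup>2 / 2) * ennreal (?k s t)) \<partial>lborel \<partial>lborel)"
  proof (rule nn_integral_mono)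
    fix s
    have "ennreal (cmod (f s * (LINT t|lborel. cnj (f t) * complex_of_real (?k s t))))
       \<le> ennreal (cmod (f s)) * (\<integral>\<^sup>+t. ennreal (cmod (cnj (f t) * complex_of_real
           (?k s t))) \<partial>lborel)"
      unfolding norm_mult[of "f s"] by (subst ennreal_mult)
          (auto intro!: mult_left_mono integral_norm_bound_ennreal')
    also have "\<dots> = (\<integral>\<^sup>+t. ennreal (cmod (f s)) * ennreal (cmod (cnj (f t) * complex_of_real
        (?k s t))) \<partial>lborel)"
      by (rule nn_integral_cmult[symmetric]) measurable
    also have "\<dots> \<le> (\<integral>\<^sup>+t. (ennreal ((cmod (f s))\<^sup>2 / 2) * ennreal (?k s t)
       + ennreal ((cmod (f t))\<^sup>2 / 2) * ennreal (?k s t)) \<partial>lborel)"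
    proof (rule nn_integral_mono)
      fix t
      have "cmod (f s) * cmod (f t) \<le> (cmod (f s))\<^sup>2 / 2 + (cmod (f t))\<^sup>2 / 2"
        using sum_squares_bound[of "cmod (f s)" "cmod (f t)"] by (simp add: field_simps)
      then have "cmod (f s) * cmod (f t) * ?k s t
          \<le> ((cmod (f s))\<^sup>2 / 2 + (cmod (f t))\<^sup>2 / 2) * ?k s t"
        using \<sigma> by (intro mult_right_mono) auto
      then show "ennreal (cmod (f s)) * ennreal (cmod (cnj (f t) * complex_of_real (?k s t)))
        \<le> ennreal ((cmod (f s))\<^sup>2 / 2) * ennreal (?k s t)
            + ennreal ((cmod (f t))\<^sup>2 / 2) * ennreal (?k s t)"
        using \<sigma> by (simp add: norm_mult abs_mult mult.assoc distrib_right flip: ennreal_mult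
            ennreal_plus)
    qed
    finally show "ennreal (cmod (f s * (LINT t|lborel. cnj (f t) * complex_of_real (?k s t))))
      \<le> (\<integral>\<^sup>+t. (ennreal ((cmod (f s))\<^sup>2 / 2) * ennreal (?k s t)
       + ennreal ((cmod (f t))\<^sup>2 / 2) * ennreal (?k s t)) \<partial>lborel)" .
  qed
  also have "\<dots> = (\<integral>\<^sup>+s. \<integral>\<^sup>+t. ennreal ((cmod (f s))\<^sup>2 / 2) * ennreal (?k s t) \<partial>lborel \<partial>lborel)
       + (\<integral>\<^sup>+s. \<integral>\<^sup>+t. ennreal ((cmod (f t))\<^sup>2 / 2) * ennreal (?k s t) \<partial>lborel \<partial>lborel)"
    by (simp add: nn_integral_add)
  also have "(\<integral>\<^sup>+s. \<integral>\<^sup>+t. ennreal ((cmod (f t))\<^sup>2 / 2) * ennreal (?k s t) \<partial>lborel \<partial>lborel)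
      = (\<integral>\<^sup>+t. \<integral>\<^sup>+s. ennreal ((cmod (f t))\<^sup>2 / 2) * ennreal (?k s t) \<partial>lborel \<partial>lborel)"
    by (rule lborel_pair.Fubini') measurable
  also have "(\<integral>\<^sup>+s. \<integral>\<^sup>+t. ennreal ((cmod (f s))\<^sup>2 / 2) * ennreal (?k s t) \<partial>lborel \<partial>lborel)
      + (\<integral>\<^sup>+t. \<integral>\<^sup>+s. ennreal ((cmod (f t))\<^sup>2 / 2) * ennreal (?k s t) \<partial>lborel \<partial>lborel)
    = ennreal (sq_norm lborel f / 2) * ennreal (sqrt (2 * pi))
        + ennreal (sq_norm lborel f / 2) * ennreal (sqrt (2 * pi))"
    by (simp add: nn_integral_cmult nn_integral_multc sq
          nn_integral_gaussian_kernel[OF \<sigma>, simplified] nn_integral_gaussian_kernel'[OF \<sigma>,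
              simplified])
  also have "\<dots> = ennreal (sqrt (2 * pi) * sq_norm lborel f)"
    by (simp flip: ennreal_mult ennreal_plus)
  finally show ?thesis .
qed

lemma std_normal_density_lim: "(\<lambda>n. std_normal_density (\<omega> / real (Suc n))) \<longlonglongrightarrow> 1 / sqrt (2 * pi)"
proof -
  have "(\<lambda>n. std_normal_density (\<omega> * inverse (real (Suc n)))) \<longlonglongrightarrow> std_normal_density (\<omega> * 0)"
    unfolding std_normal_density_def
    by (intro tendsto_intros LIMSEQ_inverse_real_of_nat) auto
  then show ?thesis
    by (simp add: std_normal_density_def field_simps)
qed

text \<open>Fatou's lemma as the Gaussian widens. The weight tends to
  \<open>1 / sqrt (2 * pi)\<close> and the uniform bound has the factor
  \<open>sqrt (2 * pi)\<close>; together they give \<open>2 * pi\<close>. Fatou yields only an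
  inequality, but that already secures square integrability.\<close>

lemma Bessel_fourier:
  assumes f: "integrable lborel f" "square_integrable lborel f"
  shows "square_integrable lborel (fourier f)"
      "sq_norm lborel (fourier f) \<le> 2 * pi * sq_norm lborel f"
proof -
  have [measurable]: "f \<in> borel_measurable borel"
    using f by (auto dest: borel_measurable_integrable)
  let ?S = "sq_norm lborel f"
  let ?c = "1 / sqrt (2 * pi)"
  let ?u = "\<lambda>n \<omega>. ennreal ((cmod (fourier f \<omega>))\<^sup>2 * std_normal_density (\<omega> / real (Suc n)))"
  have S: "?S \<ge> 0" by simp
  have "(\<lambda>n. ?u n \<omega>) \<longlonglongrightarrow> ennreal ((cmod (fourier f \<omega>))\<^sup>2 * ?c)" for \<omega>
    by (intro tendsto_ennrealI tendsto_mult tendsto_const std_normal_density_lim)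
  then have lim: "liminf (\<lambda>n. ?u n \<omega>) = ennreal ((cmod (fourier f \<omega>))\<^sup>2 * ?c)" for \<omega>
    by (intro lim_imp_Liminf) auto
  have "(\<integral>\<^sup>+\<omega>. ennreal ((cmod (fourier f \<omega>))\<^sup>2 * ?c) \<partial>lborel) \<le> liminf (\<lambda>n. \<integral>\<^sup>+\<omega>. ?u n \<omega> \<partial>lborel)"
    unfolding lim[symmetric] by (rule nn_integral_liminf) measurable
  also have "\<dots> \<le> liminf (\<lambda>n::nat. ennreal (sqrt (2 * pi) * ?S))"
    by (intro Liminf_mono always_eventually allI nn_integral_fourier_gaussian_le f) simp
  also have "\<dots> = ennreal (sqrt (2 * pi) * ?S)"
    by (simp add: Liminf_const)
  finally have *: "(\<integral>\<^sup>+\<omega>. ennreal ((cmod (fourier f \<omega>))\<^sup>2 * ?c) \<partial>lborel)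
      \<le> ennreal (sqrt (2 * pi) * ?S)" .
  have "(\<integral>\<^sup>+\<omega>. ennreal ((cmod (fourier f \<omega>))\<^sup>2) \<partial>lborel)
     = (\<integral>\<^sup>+\<omega>. ennreal (sqrt (2 * pi)) * ennreal ((cmod (fourier f \<omega>))\<^sup>2 * ?c) \<partial>lborel)"
    by (simp flip: ennreal_mult)
  also have "\<dots> = ennreal (sqrt (2 * pi)) * (\<integral>\<^sup>+\<omega>. ennreal ((cmod (fourier f \<omega>))\<^sup>2 * ?c) \<partial>lborel)"
    by (rule nn_integral_cmult) measurable
  also have "\<dots> \<le> ennreal (sqrt (2 * pi)) * ennreal (sqrt (2 * pi) * ?S)"
    by (intro mult_left_mono *) auto
  also have "\<dots> = ennreal (2 * pi * ?S)"
    by (simp flip: ennreal_mult mult.assoc)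
  finally have le: "(\<integral>\<^sup>+\<omega>. ennreal ((cmod (fourier f \<omega>))\<^sup>2) \<partial>lborel) \<le> ennreal (2 * pi * ?S)" .
  show sq: "square_integrable lborel (fourier f)"
    unfolding square_integrable_def
  proof
    show "fourier f \<in> borel_measurable lborel" by measurable
    show "integrable lborel (\<lambda>x. (cmod (fourier f x))\<^sup>2)"
      using le by (intro integrableI_bounded) (auto simp: top_unique intro: le_less_trans)
  qed
  then have "ennreal (sq_norm lborel (fourier f)) \<le> ennreal (2 * pi * ?S)"
    using le by (subst (asm) nn_integral_eq_integral) (auto simp: square_integrable_def)
  then show "sq_norm lborel (fourier f) \<le> 2 * pi * ?S"
    by (subst (asm) ennreal_le_iff) auto
qed

lemma gaussian_convolution_lim:
  fixes f :: "real \<Rightarrow> complex"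
  assumes f: "continuous_on UNIV f" and B: "\<And>x. cmod (f x) \<le> B"
  shows "(\<lambda>n. LINT t|lborel. f t * complex_of_real (real (Suc n) * exp (- (real (Suc n) * (s
      - t))\<^sup>2 / 2)))
           \<longlonglongrightarrow> sqrt (2 * pi) * f s"
    and "\<sigma> > 0 \<Longrightarrow> cmod (LINT t|lborel. f t * complex_of_real (\<sigma> * exp (- (\<sigma> * (s - t))\<^sup>2 / 2)))
        \<le> B * sqrt (2 * pi)"
proof -
  have [measurable]: "f \<in> borel_measurable borel"
    using f by (rule borel_measurable_continuous_onI)
  \<comment> \<open>Substituting \<open>t = s - u / \<sigma>\<close> moves \<open>\<sigma>\<close>
    from the kernel into the argument of \<open>f\<close>, so that one fixed Gaussian dominates the
    integrands for all \<open>\<sigma>\<close>.\<close>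
  let ?v = "\<lambda>\<sigma> u. f (s - u / \<sigma>) * complex_of_real (sqrt (2 * pi) * std_normal_density u)"
  have eq: "(LINT t|lborel. f t * complex_of_real (\<sigma> * exp (- (\<sigma> * (s - t))\<^sup>2 / 2)))
      = (LINT u|lborel. ?v \<sigma> u)"
    if "\<sigma> > 0" for \<sigma>
  proof -
    have "(LINT t|lborel. f t * complex_of_real (\<sigma> * exp (- (\<sigma> * (s - t))\<^sup>2 / 2)))
      = \<bar>- (1 / \<sigma>)\<bar> *\<^sub>R (LINT u|lborel. f (s + (- (1 / \<sigma>)) * u) * complex_of_real (\<sigma> * exp (- (\<sigma> *
          (s - (s + (- (1 / \<sigma>)) * u)))\<^sup>2 / 2)))"
      using that by (intro lborel_integral_real_affine) auto
    also have "\<dots> = (LINT u|lborel. \<bar>- (1 / \<sigma>)\<bar> *\<^sub>R (f (s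
        + (- (1 / \<sigma>)) * u) * complex_of_real (\<sigma> * exp (- (\<sigma> * (s - (s
        + (- (1 / \<sigma>)) * u)))\<^sup>2 / 2))))"
      by simp
    also have "\<dots> = (LINT u|lborel. ?v \<sigma> u)"
      using that by (intro Bochner_Integration.integral_cong refl)
        (simp add: std_normal_density_def scaleR_conv_of_real field_simps)
    finally show ?thesis .
  qed
  have int: "integrable lborel (\<lambda>u. B * sqrt (2 * pi) * std_normal_density u)"
    by simp
  have bd: "cmod (?v \<sigma> u) \<le> B * sqrt (2 * pi) * std_normal_density u" for \<sigma> u
    using mult_right_mono[OF B, of "sqrt (2 * pi) * std_normal_density u"]
        by (simp add: norm_mult abs_mult mult.assoc)
  have "(\<lambda>n. LINT u|lborel. ?v (real (Suc n)) u)
      \<longlonglongrightarrow> (LINT u|lborel. f s * complex_of_real (sqrt (2 * pi) * std_normal_density u))"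
  proof (rule integral_dominated_convergence[OF _ _ int])
    show "AE u in lborel. (\<lambda>n. ?v (real (Suc n)) u)
        \<longlonglongrightarrow> f s * complex_of_real (sqrt (2 * pi) * std_normal_density u)"
    proof (intro AE_I2 tendsto_mult tendsto_const)
      fix u
      have "(\<lambda>n. s - u * inverse (real (Suc n))) \<longlonglongrightarrow> s - u * 0"
        by (intro tendsto_intros LIMSEQ_inverse_real_of_nat)
      then have "(\<lambda>n. s - u / real (Suc n)) \<longlonglongrightarrow> s"
        by (simp add: field_simps)
      moreover have "isCont f s"
        using f by (simp add: continuous_on_eq_continuous_at)
      ultimately show "(\<lambda>n. f (s - u / real (Suc n))) \<longlonglongrightarrow> f s"
        by (rule isCont_tendsto_compose[rotated])
    qed
    show "AE u in lborel. cmod (?v (real (Suc n)) u) \<le> B * sqrt (2 * pi) * std_normal_density u"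
        for n
      using bd by blast
  qed measurable
  moreover have "(LINT u|lborel. f s * complex_of_real (sqrt (2 * pi) * std_normal_density u))
      = sqrt (2 * pi) * f s"
    by simp
  ultimately show "(\<lambda>n. LINT t|lborel. f t * complex_of_real (real (Suc n) * exp (- (real (Suc n) *
      (s - t))\<^sup>2 / 2)))
           \<longlonglongrightarrow> sqrt (2 * pi) * f s"
    by (simp only: eq[OF of_nat_0_less_iff[THEN iffD2, OF zero_less_Suc]])
  show "cmod (LINT t|lborel. f t * complex_of_real (\<sigma> * exp (- (\<sigma> * (s - t))\<^sup>2 / 2)))
      \<le> B * sqrt (2 * pi)" if "\<sigma> > 0"
  proof -
    have "cmod (LINT u|lborel. ?v \<sigma> u) \<le> (LINT u|lborel. B * sqrt (2 * pi) * std_normal_density u)"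
    proof (rule Bochner_Integration.integral_norm_bound_integral[OF
        Bochner_Integration.integrable_bound[OF int] int])
      show "AE u in lborel. cmod (?v \<sigma> u) \<le> norm (B * sqrt (2 * pi) * std_normal_density u)"
        using bd by (intro AE_I2) (metis abs_ge_self order_trans real_norm_def)
    qed (measurable, rule bd)
    then show ?thesis unfolding eq[OF that] by simp
  qed
qed

section \<open>Parseval's identity\<close>

text \<open>Both sides of \<open>gaussian_regularization\<close> converge: the frequency side
  because Bessel's inequality makes the unweighted product integrable, the time side because the
  kernel concentrates. Continuity and boundedness are asked of \<open>f\<close> alone, the factor on
  which the kernel acts. The limits carry \<open>1 / sqrt (2 * pi)\<close> and
  \<open>sqrt (2 * pi)\<close>, whence \<open>2 * pi\<close>.\<close>

lemma Parseval_continuous: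
  assumes g: "integrable lborel g" "square_integrable lborel g"
    and f: "integrable lborel f" "square_integrable lborel f"
    and cont: "continuous_on UNIV f" and B: "\<And>x. cmod (f x) \<le> B"
  shows "(LINT \<omega>|lborel. fourier g \<omega> * cnj (fourier f \<omega>))
      = 2 * pi * (LINT t|lborel. g t * cnj (f t))"
proof -
  have [measurable]: "f \<in> borel_measurable borel" "g \<in> borel_measurable borel"
    using f g by (auto dest: borel_measurable_integrable)
  let ?\<gamma> = "\<lambda>n \<omega>. complex_of_real (std_normal_density (\<omega> / real (Suc n)))"
  let ?k = "\<lambda>n s t. complex_of_real (real (Suc n) * exp (- (real (Suc n) * (s - t))\<^sup>2 / 2))"
  let ?p = "\<lambda>\<omega>. fourier g \<omega> * cnj (fourier f \<omega>)"
  have p: "integrable lborel ?p"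
    by (intro square_integrable_integrable_mult Bessel_fourier f g)
  have "(\<lambda>n. LINT \<omega>|lborel. ?p \<omega> * ?\<gamma> n \<omega>) \<longlonglongrightarrow> (LINT \<omega>|lborel. ?p \<omega> * complex_of_real (1 / sqrt (2
      * pi)))"
  proof (rule integral_dominated_convergence)
    show "integrable lborel (\<lambda>\<omega>. cmod (?p \<omega>) * (1 / sqrt (2 * pi)))"
      using p by (intro integrable_mult_left integrable_norm)
    show "AE \<omega> in lborel. (\<lambda>n. ?p \<omega> * ?\<gamma> n \<omega>) \<longlonglongrightarrow> ?p \<omega> * complex_of_real (1 / sqrt (2 * pi))"
      by (intro AE_I2 tendsto_mult tendsto_const tendsto_of_real std_normal_density_lim)
    show "AE \<omega> in lborel. cmod (?p \<omega> * ?\<gamma> n \<omega>) \<le> cmod (?p \<omega>) * (1 / sqrt (2 * pi))" for n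
    proof (intro AE_I2)
      show "cmod (?p \<omega> * ?\<gamma> n \<omega>) \<le> cmod (?p \<omega>) * (1 / sqrt (2 * pi))" for \<omega>
        unfolding norm_mult[of "?p \<omega>"] norm_of_real
        by (intro mult_left_mono norm_ge_zero) (simp add: std_normal_density_le del: mult_1)
    qed
  qed measurable
  moreover have "(\<lambda>n. LINT \<omega>|lborel. ?p \<omega> * ?\<gamma> n \<omega>)
      \<longlonglongrightarrow> (LINT s|lborel. g s * (sqrt (2 * pi) * cnj (f s)))"
    unfolding gaussian_regularization[OF g(1) f(1) of_nat_0_less_iff[THEN iffD2, OF zero_less_Suc]]
  proof (rule integral_dominated_convergence)
    have cf: "continuous_on UNIV (\<lambda>x. cnj (f x))" "\<And>x. cmod (cnj (f x)) \<le> B"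
      using cont B by (auto intro: continuous_intros)
    show "integrable lborel (\<lambda>s. cmod (g s) * (B * sqrt (2 * pi)))"
      using g(1) by (intro integrable_mult_left integrable_norm)
    show "AE s in lborel. (\<lambda>n. g s * (LINT t|lborel. cnj (f t) * ?k n s t))
        \<longlonglongrightarrow> g s * (sqrt (2 * pi) * cnj (f s))"
      by (intro AE_I2 tendsto_mult tendsto_const gaussian_convolution_lim(1)[OF cf])
    show "AE s in lborel. cmod (g s * (LINT t|lborel. cnj (f t) * ?k n s t))
        \<le> cmod (g s) * (B * sqrt (2 * pi))" for n
      unfolding norm_mult[of "g s" for s]
      by (intro AE_I2 mult_left_mono norm_ge_zero gaussian_convolution_lim(2)[OF cf]) simp
    show "(\<lambda>s. g s * (LINT t|lborel. cnj (f t) * ?k n s t)) \<in> borel_measurable lborel" for n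
      by (intro borel_measurable_times lborel.borel_measurable_lebesgue_integral) measurable
  qed measurable
  ultimately have "(LINT \<omega>|lborel. ?p \<omega> * complex_of_real (1 / sqrt (2 * pi)))
      = (LINT s|lborel. g s * (sqrt (2 * pi) * cnj (f s)))"
    by (rule LIMSEQ_unique)
  also have "\<dots> = (LINT s|lborel. complex_of_real (sqrt (2 * pi)) * (g s * cnj (f s)))"
    by (simp only: mult.left_commute mult.assoc)
  finally have "(LINT \<omega>|lborel. ?p \<omega>) * complex_of_real (1 / sqrt (2 * pi))
      = complex_of_real (sqrt (2 * pi)) * (LINT s|lborel. g s * cnj (f s))"
    by (simp only: integral_mult_left_zero integral_mult_right_zero)
  then have "complex_of_real (sqrt (2 * pi)) * ((LINT \<omega>|lborel. ?p \<omega>) * complex_of_real (1 / sqrt (2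
      * pi)))
     = complex_of_real (sqrt (2 * pi) * sqrt (2 * pi)) * (LINT s|lborel. g s * cnj (f s))"
    by (simp only: of_real_mult mult.assoc)
  also have "complex_of_real (sqrt (2 * pi)) * ((LINT \<omega>|lborel. ?p \<omega>) * complex_of_real (1 / sqrt (2
      * pi)))
     = (LINT \<omega>|lborel. ?p \<omega>) * complex_of_real (sqrt (2 * pi) * (1 / sqrt (2 * pi)))"
    by (simp only: of_real_mult mult_ac)
  finally show ?thesis by simp
qed

text \<open>A Lebesgue measurable function is an almost-everywhere limit of continuous functions,
  but these come without a common bound. Clamping their values and cutting off their support
  supplies one and leaves the limit \<open>u\<close> unchanged, so dominated convergence applies.
  \<open>K\<close> bounds both the values and the support of \<open>u\<close>.\<close>

lemma bounded_support_continuous_approx: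
  assumes u [measurable]: "u \<in> borel_measurable borel" and K: "K \<ge> 1"
    and bd: "\<And>t. cmod (u t) \<le> K" and supp: "\<And>t. \<bar>t\<bar> > K \<Longrightarrow> u t = 0" and e: "e > 0"
  shows "\<exists>c. continuous_on UNIV c \<and> (\<forall>x. cmod (c x) \<le> K) \<and> integrable lborel c
      \<and> square_integrable lborel c \<and> sq_norm lborel (\<lambda>x. u x - c x) < e"
proof -
  have "u \<in> borel_measurable lebesgue"
    using u by (auto intro: measurable_completion)
  then have "u measurable_on UNIV"
    by (rule lebesgue_measurable_imp_measurable_on) simp
  then obtain N g where N: "negligible N" and g: "\<And>n. continuous_on UNIV (g n)"
    and lim: "\<And>x. x \<notin> N \<Longrightarrow> (\<lambda>n. g n x) \<longlonglongrightarrow> u x"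
    unfolding measurable_on_def by auto
  \<comment> \<open>Radial retraction onto the disc of radius \<open>K\<close>; it fixes every value
    of \<open>u\<close>.\<close>
  define cl where "cl = (\<lambda>z. complex_of_real (K / max K (cmod z)) * z)"
  \<comment> \<open>Trapezoid equal to 1 on \<open>{-K..K}\<close> and to 0 outside
    \<open>{-(K + 1)..K + 1}\<close>.\<close>
  define \<eta> where "\<eta> = (\<lambda>t. max 0 (min 1 (K + 1 - \<bar>t\<bar>)))"
  define c where "c = (\<lambda>n t. complex_of_real (\<eta> t) * cl (g n t))"
  let ?I = "indicator {- (K + 1) .. K + 1} :: real \<Rightarrow> real"
  have cl_cont: "continuous_on UNIV cl"
    unfolding cl_def using K by (intro continuous_intros) auto
  have cl_le: "cmod (cl z) \<le> K" for z
  proof -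
    have "K / max K (cmod z) * cmod z = K * (cmod z / max K (cmod z))"
      by simp
    also have "\<dots> \<le> K * 1"
      using K by (intro mult_left_mono) (auto simp: divide_le_eq_1)
    finally have "K / max K (cmod z) * cmod z \<le> K"
      by simp
    moreover have "0 \<le> K / max K (cmod z)"
      using K by simp
    ultimately show ?thesis
      unfolding cl_def norm_mult norm_of_real by (simp only: abs_of_nonneg)
  qed
  have cl_u: "cl (u t) = u t" for t
    using bd[of t] K by (simp add: cl_def max_def)
  have \<eta>_cont: "continuous_on UNIV \<eta>"
    unfolding \<eta>_def by (intro continuous_intros)
  have \<eta>_le: "0 \<le> \<eta> t" "\<eta> t \<le> ?I t" for t
    using K by (auto simp: \<eta>_def indicator_def)
  have \<eta>_u: "complex_of_real (\<eta> t) * u t = u t" for t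
    using supp[of t] by (cases "\<bar>t\<bar> > K") (auto simp: \<eta>_def min_def max_def)
  have c_cont: "continuous_on UNIV (c n)" for n
    unfolding c_def
    by (intro continuous_intros \<eta>_cont continuous_on_compose2[OF cl_cont g]) auto
  have [measurable]: "c n \<in> borel_measurable borel" for n
    using c_cont by (rule borel_measurable_continuous_onI)
  have c_le: "cmod (c n t) \<le> K * ?I t" for n t
    using mult_mono[OF \<eta>_le(2)[of t] cl_le[of "g n t"]] \<eta>_le(1)[of t] K
    by (simp add: c_def norm_mult mult.commute)
  have u_le: "cmod (u t) \<le> K * ?I t" for t
    using bd[of t] supp[of t] K by (cases "\<bar>t\<bar> > K") (auto simp: indicator_def)
  have I: "integrable lborel (\<lambda>t. C * ?I t)" for C
    by (intro integrable_mult_right integrable_real_indicator) (auto simp: emeasure_lborel_Icc_eq)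
  have AE: "AE t in lborel. t \<notin> N"
    using N by (metis AE_completion_iff AE_not_in negligible_iff_null_sets)
  have sq_le: "(cmod z)\<^sup>2 \<le> M\<^sup>2 * ?I t" if "cmod z \<le> M * ?I t" for z M t
    using power_mono[OF that, of 2] by (auto simp: indicator_def split: if_splits)
  have "(\<lambda>n. sq_norm lborel (\<lambda>x. u x - c n x)) \<longlonglongrightarrow> (LINT t::real|lborel. 0)"
  proof (rule integral_dominated_convergence)
    show "integrable lborel (\<lambda>t. (2 * K)\<^sup>2 * ?I t)" by (rule I)
    show "AE t in lborel. norm ((cmod (u t - c n t))\<^sup>2) \<le> (2 * K)\<^sup>2 * ?I t" for n
    proof (intro AE_I2)
      fix t
      have "cmod (u t - c n t) \<le> 2 * K * ?I t"
        using norm_triangle_ineq4[of "u t" "c n t"] u_le[of t] c_le[of n t] by simp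
      from sq_le[OF this] show "norm ((cmod (u t - c n t))\<^sup>2) \<le> (2 * K)\<^sup>2 * ?I t"
        by (simp only: real_norm_def abs_power2)
    qed
    have "(\<lambda>n. (cmod (u t - c n t))\<^sup>2) \<longlonglongrightarrow> 0" if "t \<notin> N" for t
    proof -
      have "(\<lambda>n. cl (g n t)) \<longlonglongrightarrow> cl (u t)"
        using cl_cont lim[OF that] by (auto intro: isCont_tendsto_compose simp:
            continuous_on_eq_continuous_at)
      then have "(\<lambda>n. c n t) \<longlonglongrightarrow> complex_of_real (\<eta> t) * cl (u t)"
        unfolding c_def by (intro tendsto_intros)
      then have "(\<lambda>n. c n t) \<longlonglongrightarrow> u t"
        by (simp only: cl_u \<eta>_u)
      then have "(\<lambda>n. (cmod (u t - c n t))\<^sup>2) \<longlonglongrightarrow> (cmod (u t - u t))\<^sup>2"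
        by (intro tendsto_intros)
      then show ?thesis by simp
    qed
    then show "AE t in lborel. (\<lambda>n. (cmod (u t - c n t))\<^sup>2) \<longlonglongrightarrow> 0"
      using AE by auto
  qed measurable
  then have "\<forall>\<^sub>F n in sequentially. sq_norm lborel (\<lambda>x. u x - c n x) < e"
    using e by (intro order_tendstoD(2)) auto
  then obtain n where "sq_norm lborel (\<lambda>x. u x - c n x) < e"
    by (auto simp: eventually_sequentially)
  moreover have "integrable lborel (c n)"
    using c_le by (intro Bochner_Integration.integrable_bound[OF I[of K]])
        (auto intro: order_trans[OF _ abs_ge_self])
  moreover have "square_integrable lborel (c n)"
    using sq_le[OF c_le] by (intro square_integrable_bound[OF I[of "K\<^sup>2"]]) auto
  moreover have "cmod (c n x) \<le> K" for x
    using c_le[of n x] K by (cases "x \<in> {- (K + 1)..K + 1}") auto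
  ultimately show ?thesis
    using c_cont by blast
qed

lemma square_integrable_continuous_approx:
  fixes f :: "real \<Rightarrow> complex"
  assumes f: "square_integrable lborel f" and e: "e > 0"
  shows "\<exists>c B. continuous_on UNIV c \<and> (\<forall>x. cmod (c x) \<le> B) \<and> integrable lborel c
      \<and> square_integrable lborel c \<and> sq_norm lborel (\<lambda>x. f x - c x) < e"
proof -
  have [measurable]: "f \<in> borel_measurable borel"
    using f by (auto simp: square_integrable_def)
  \<comment> \<open>Restricting argument and value by the same number gives exactly the hypotheses
    on \<open>u\<close> in the previous lemma; \<open>Suc n\<close> ensures the bound is at least
    1.\<close>
  define A where "A = (\<lambda>n. {t. \<bar>t\<bar> \<le> real (Suc n) \<and> cmod (f t) \<le> real (Suc n)})"
  have [measurable]: "A n \<in> sets borel" for n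
    unfolding A_def by measurable
  have ev: "\<forall>\<^sub>F n in sequentially. t \<in> A n" for t
  proof -
    obtain k where "max \<bar>t\<bar> (cmod (f t)) \<le> real k"
      using real_arch_simple by blast
    then show ?thesis
      unfolding eventually_sequentially A_def by (intro exI[of _ k]) auto
  qed
  have "(\<lambda>n. sq_norm lborel (\<lambda>x. f x - indicator (A n) x * f x)) \<longlonglongrightarrow> 0"
    by (rule square_integrable_cutoff[OF f _ ev]) simp
  \<comment> \<open>Two errors below \<open>e / 4\<close>, each doubled by
    \<open>sq_norm_diff_le\<close>, add up to less than \<open>e\<close>.\<close>
  then have "\<forall>\<^sub>F n in sequentially. sq_norm lborel (\<lambda>x. f x - indicator (A n) x * f x) < e / 4"
    using e by (intro order_tendstoD(2)) auto
  then obtain n where n: "sq_norm lborel (\<lambda>x. f x - indicator (A n) x * f x) < e / 4"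
    by (auto simp: eventually_sequentially)
  let ?u = "\<lambda>x. indicator (A n) x * f x"
  have u: "square_integrable lborel ?u"
    by (rule square_integrable_cmult[OF f, of _ 1]) (auto simp: indicator_def)
  have "\<exists>c. continuous_on UNIV c \<and> (\<forall>x. cmod (c x) \<le> real (Suc n)) \<and> integrable lborel c
      \<and> square_integrable lborel c \<and> sq_norm lborel (\<lambda>x. ?u x - c x) < e / 4"
    by (rule bounded_support_continuous_approx) (use e in \<open>auto simp: A_def indicator_def\<close>)
  then obtain c where c: "continuous_on UNIV c" "\<And>x. cmod (c x) \<le> real (Suc n)"
      "integrable lborel c"
     "square_integrable lborel c" and c4: "sq_norm lborel (\<lambda>x. ?u x - c x) < e / 4"
    by blast
  have "sq_norm lborel (\<lambda>x. f x - c x)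
      \<le> 2 * sq_norm lborel (\<lambda>x. f x - ?u x) + 2 * sq_norm lborel (\<lambda>x. ?u x - c x)"
    by (rule sq_norm_diff_le[OF f u c(4)])
  also have "\<dots> < e"
    using n c4 by simp
  finally show ?thesis
    using c by blast
qed

text \<open>Only the second factor is approximated; \<open>f\<close> stays fixed throughout.
  Bessel's inequality for \<open>c n - g\<close> carries the convergence over to the
  transforms.\<close>

theorem Parseval_fourier:
  assumes f: "integrable lborel f" "square_integrable lborel f"
    and g: "integrable lborel g" "square_integrable lborel g"
  shows "(LINT \<omega>|lborel. fourier f \<omega> * cnj (fourier g \<omega>))
      = 2 * pi * (LINT t|lborel. f t * cnj (g t))"
proof -
  have "\<forall>n. \<exists>c. continuous_on UNIV c \<and> (\<exists>B. \<forall>x. cmod (c x) \<le> B) \<and> integrable lborel c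
      \<and> square_integrable lborel c \<and> sq_norm lborel (\<lambda>x. g x - c x) < inverse (real (Suc n))"
  proof
    fix n
    have "inverse (real (Suc n)) > 0" by simp
    from square_integrable_continuous_approx[OF g(2) this]
    show "\<exists>c. continuous_on UNIV c \<and> (\<exists>B. \<forall>x. cmod (c x) \<le> B) \<and> integrable lborel c
      \<and> square_integrable lborel c \<and> sq_norm lborel (\<lambda>x. g x - c x) < inverse (real (Suc n))"
      by blast
  qed
  from choice[OF this] obtain c where c: "\<And>n. continuous_on UNIV (c n)"
      "\<And>n. \<exists>B. \<forall>x. cmod (c n x) \<le> B"
    "\<And>n. integrable lborel (c n)" "\<And>n. square_integrable lborel (c n)"
    and le: "\<And>n. sq_norm lborel (\<lambda>x. g x - c n x) < inverse (real (Suc n))"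
    by blast
  have lim: "(\<lambda>n. sq_norm lborel (\<lambda>x. c n x - g x)) \<longlonglongrightarrow> 0"
  proof (rule tendsto_sandwich[OF _ _ tendsto_const LIMSEQ_inverse_real_of_nat])
    show "\<forall>\<^sub>F n in sequentially. sq_norm lborel (\<lambda>x. c n x - g x) \<le> inverse (real (Suc n))"
      using le by (auto simp: norm_minus_commute intro!: always_eventually less_imp_le)
  qed simp
  have lim': "(\<lambda>n. sq_norm lborel (\<lambda>x. fourier (c n) x - fourier g x)) \<longlonglongrightarrow> 0"
  proof (rule tendsto_sandwich[OF _ _ tendsto_const])
    show "(\<lambda>n. 2 * pi * sq_norm lborel (\<lambda>x. c n x - g x)) \<longlonglongrightarrow> 0"
      using tendsto_mult_right_zero[OF lim] .
    show "\<forall>\<^sub>F n in sequentially. sq_norm lborel (\<lambda>x. fourier (c n) x - fourier g x)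
        \<le> 2 * pi * sq_norm lborel (\<lambda>x. c n x - g x)"
      using Bessel_fourier(2)[OF Bochner_Integration.integrable_diff[OF c(3) g(1)]
          square_integrable_diff[OF c(4) g(2)]]
      by (simp add: fourier_diff[OF c(3) g(1)])
  qed simp
  have "(\<lambda>n. LINT \<omega>|lborel. fourier f \<omega> * cnj (fourier (c n) \<omega>))
      \<longlonglongrightarrow> (LINT \<omega>|lborel. fourier f \<omega> * cnj (fourier g \<omega>))"
    by (intro tendsto_inner lim' Bessel_fourier f g c) simp
  moreover have "(\<lambda>n. 2 * pi * (LINT t|lborel. f t * cnj (c n t)))
      \<longlonglongrightarrow> 2 * pi * (LINT t|lborel. f t * cnj (g t))"
    by (intro tendsto_mult tendsto_const tendsto_inner lim f g c) simp
  moreover have "(LINT \<omega>|lborel. fourier f \<omega> * cnj (fourier (c n) \<omega>))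
      = 2 * pi * (LINT t|lborel. f t * cnj (c n t))" for n
    using c(2)[of n] Parseval_continuous[OF f c(3) c(4) c(1)] by blast
  ultimately show ?thesis
    by (simp only: LIMSEQ_unique)
qed

section \<open>The Fourier transform of square-integrable functions\<close>

text \<open>Truncation makes a square-integrable function integrable, so that \<open>fourier\<close>
  applies; this is the family whose limit in the mean defines \<open>is_L2_fourier\<close>.\<close>

definition trunc :: "real \<Rightarrow> (real \<Rightarrow> complex) \<Rightarrow> real \<Rightarrow> complex" where
  "trunc R f t = indicator {-R..R} t * f t"

lemma square_integrable_trunc:
  "square_integrable lborel f \<Longrightarrow> square_integrable lborel (trunc R f)"
  unfolding trunc_def[abs_def]
  by (rule square_integrable_cmult[of _ _ _ 1]) (auto simp: indicator_def)

lemma integrable_trunc: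
  assumes "square_integrable lborel f"
  shows "integrable lborel (trunc R f)"
proof -
  have "square_integrable lborel (indicator {-R..R})"
    by (rule square_integrable_bound[OF integrable_real_indicator[of "{-R..R}"]])
       (auto simp: indicator_def emeasure_lborel_Icc_eq)
  from square_integrable_integrable_mult[OF assms this] show ?thesis
    by (rule Bochner_Integration.integrable_cong[THEN iffD1,
        rotated 2]) (auto simp: trunc_def indicator_def)
qed

lemma trunc_tendsto:
  assumes f: "square_integrable lborel f"
  shows "((\<lambda>R. sq_norm lborel (\<lambda>t. f t - trunc R f t)) \<longlongrightarrow> 0) at_top"
proof (rule tendsto_at_topI_sequentially)
  fix X :: "nat \<Rightarrow> real" assume X: "filterlim X at_top sequentially"
  show "(\<lambda>n. sq_norm lborel (\<lambda>t. f t - trunc (X n) f t)) \<longlonglongrightarrow> 0"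
    unfolding trunc_def
  proof (rule square_integrable_cutoff[OF f])
    fix t :: real
    have "\<forall>\<^sub>F n in sequentially. \<bar>t\<bar> \<le> X n"
      using X by (simp add: filterlim_at_top)
    then show "\<forall>\<^sub>F n in sequentially. t \<in> {- X n..X n}"
      by eventually_elim auto
  qed simp
qed

text \<open>Bessel's inequality for differences of truncations makes their transforms a Cauchy
  family. Completeness gives a limit along integer radii, which is then shown to be the limit along
  all real radii.\<close>

lemma L2_fourier_limit_exists:
  assumes f: "square_integrable lborel f"
  obtains F where "square_integrable lborel F"
    "((\<lambda>R. sq_norm lborel (\<lambda>\<omega>. fourier (trunc R f) \<omega> - F \<omega>)) \<longlongrightarrow> 0) at_top"
proof -
  note tr = integrable_trunc[OF f] square_integrable_trunc[OF f]
  define \<Phi> where "\<Phi> = (\<lambda>R. fourier (trunc R f))"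
  define e where "e = (\<lambda>R. sq_norm lborel (\<lambda>t. f t - trunc R f t))"
  have \<Phi>: "square_integrable lborel (\<Phi> R)" for R
    unfolding \<Phi>_def by (intro Bessel_fourier tr)
  have e: "(e \<longlongrightarrow> 0) at_top"
    unfolding e_def by (rule trunc_tendsto[OF f])
  then have en: "(\<lambda>n. e (real n)) \<longlonglongrightarrow> 0"
    by (rule filterlim_compose) (rule filterlim_real_sequentially)
  have dist: "sq_norm lborel (\<lambda>\<omega>. \<Phi> R \<omega> - \<Phi> S \<omega>) \<le> 4 * pi * (e R + e S)" for R S
  proof -
    have "sq_norm lborel (\<lambda>\<omega>. \<Phi> R \<omega> - \<Phi> S \<omega>) = sq_norm lborel (fourier (\<lambda>t. trunc R f t
        - trunc S f t))"
      by (simp add: \<Phi>_def fourier_diff tr)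
    also have "\<dots> \<le> 2 * pi * sq_norm lborel (\<lambda>t. trunc R f t - trunc S f t)"
      by (intro Bessel_fourier Bochner_Integration.integrable_diff square_integrable_diff tr)
    also have "\<dots> \<le> 2 * pi * (2 * e R + 2 * e S)"
      using sq_norm_diff_le[OF tr(2) f tr(2), of R S]
      by (intro mult_left_mono) (simp_all add: e_def norm_minus_commute)
    finally show ?thesis by (simp add: algebra_simps)
  qed
  obtain F where F: "square_integrable lborel F"
      and lim: "(\<lambda>n. sq_norm lborel (\<lambda>x. \<Phi> (real n) x - F x)) \<longlonglongrightarrow> 0"
  proof (rule square_integrable_complete[of lborel "\<lambda>n. \<Phi> (real n)"])
    fix d :: real assume "d > 0"
    \<comment> \<open>Chosen so that two such terms, multiplied by the constant
      \<open>4 * pi\<close> of \<open>dist\<close>, give \<open>d\<close>.\<close>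
    then have "\<forall>\<^sub>F n in sequentially. e (real n) < d / (8 * pi)"
      by (intro order_tendstoD(2)[OF en]) auto
    then obtain N where N: "\<And>n. n \<ge> N \<Longrightarrow> e (real n) < d / (8 * pi)"
      by (auto simp: eventually_sequentially)
    have "sq_norm lborel (\<lambda>x. \<Phi> (real m) x - \<Phi> (real n) x) < d" if "m \<ge> N" "n \<ge> N" for m n
    proof -
      have "4 * pi * (e (real m) + e (real n)) < 4 * pi * (d / (8 * pi) + d / (8 * pi))"
        using N[OF that(1)] N[OF that(2)] by (intro mult_strict_left_mono add_strict_mono) auto
      also have "\<dots> = d" by (simp add: field_simps)
      finally show ?thesis using dist[of "real m" "real n"] by linarith
    qed
    then show "\<exists>N. \<forall>m\<ge>N. \<forall>n\<ge>N. sq_norm lborel (\<lambda>x. \<Phi> (real m) x - \<Phi> (real n) x) < d"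
      by blast
  qed (rule \<Phi>)
  \<comment> \<open>Comparing with an integer radius and sending that radius to infinity leaves a
    bound in terms of \<open>e R\<close> alone, valid for real \<open>R\<close>.\<close>
  have le: "sq_norm lborel (\<lambda>\<omega>. \<Phi> R \<omega> - F \<omega>) \<le> 8 * pi * e R" for R
  proof (rule LIMSEQ_le_const)
    have "(\<lambda>n. 2 * (4 * pi * (e R + e (real n))) + 2 * sq_norm lborel (\<lambda>x. \<Phi> (real n) x - F x))
       \<longlonglongrightarrow> 2 * (4 * pi * (e R + 0)) + 2 * 0"
      by (intro tendsto_intros en lim)
    then show "(\<lambda>n. 2 * (4 * pi * (e R + e (real n))) + 2 * sq_norm lborel (\<lambda>x. \<Phi> (real n) x - F x))
        \<longlonglongrightarrow> 8 * pi * e R"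
      by (simp add: mult.assoc)
    show "\<exists>N. \<forall>n\<ge>N. sq_norm lborel (\<lambda>\<omega>. \<Phi> R \<omega> - F \<omega>)
        \<le> 2 * (4 * pi * (e R + e (real n))) + 2 * sq_norm lborel (\<lambda>x. \<Phi> (real n) x - F x)"
    proof (intro exI allI impI)
      fix n
      show "sq_norm lborel (\<lambda>\<omega>. \<Phi> R \<omega> - F \<omega>)
        \<le> 2 * (4 * pi * (e R + e (real n))) + 2 * sq_norm lborel (\<lambda>x. \<Phi> (real n) x - F x)"
        using sq_norm_diff_le[OF \<Phi> \<Phi> F, of R "real n"] dist[of R "real n"] by linarith
    qed
  qed
  have "((\<lambda>R. sq_norm lborel (\<lambda>\<omega>. \<Phi> R \<omega> - F \<omega>)) \<longlongrightarrow> 0) at_top"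
  proof (rule tendsto_sandwich[OF _ _ tendsto_const])
    show "((\<lambda>R. 8 * pi * e R) \<longlongrightarrow> 0) at_top"
      using tendsto_mult_right_zero[OF e] .
  qed (use le in auto)
  with F show ?thesis
    unfolding \<Phi>_def by (rule that)
qed

section \<open>Passage from Lebesgue-measurable functions to Borel representatives\<close>

lemma L2_borel_representative:
  assumes "L2 f"
  obtains f' where "square_integrable lborel f'" "AE x in lborel. f x = f' x"
proof -
  have f: "f \<in> borel_measurable lebesgue" and int: "integrable lebesgue (\<lambda>t. (cmod (f t))\<^sup>2)"
    using assms by (auto simp: L2_def)
  obtain u v where [measurable]: "u \<in> borel_measurable borel" "v \<in> borel_measurable borel"
    and u: "AE x in lborel. Re (f x) = u x" and v: "AE x in lborel. Im (f x) = v x"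
    using completion_ex_borel_measurable_real[of "\<lambda>x. Re (f x)" lborel]
      completion_ex_borel_measurable_real[of "\<lambda>x. Im (f x)" lborel] f
    by (auto simp: borel_measurable_complex_iff)
  define f' where "f' = (\<lambda>x. Complex (u x) (v x))"
  have [measurable]: "f' \<in> borel_measurable borel"
    by (simp add: borel_measurable_complex_iff f'_def)
  have AE: "AE x in lborel. f x = f' x"
    using u v by eventually_elim (auto simp: f'_def complex_eq_iff)
  have "integrable lebesgue (\<lambda>t. (cmod (f' t))\<^sup>2)"
  proof (rule integrable_cong_AE_imp[OF int])
    show "(\<lambda>t. (cmod (f' t))\<^sup>2) \<in> borel_measurable lebesgue"
      by (rule measurable_completion) measurable
    show "AE x in lebesgue. (cmod (f x))\<^sup>2 = (cmod (f' x))\<^sup>2"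
      using AE_completion[OF AE] by eventually_elim simp
  qed
  then have "integrable lborel (\<lambda>t. (cmod (f' t))\<^sup>2)"
    by (subst (asm) integrable_completion) measurable
  then show ?thesis
    using AE by (intro that) (auto simp: square_integrable_def)
qed

lemma square_integrable_lborel_imp_L2:
  assumes "square_integrable lborel f"
  shows "L2 f"
proof -
  have [measurable]: "f \<in> borel_measurable lborel" and int: "integrable lborel (\<lambda>x. (cmod (f x))\<^sup>2)"
    using assms by (auto simp: square_integrable_def)
  show ?thesis
    unfolding L2_def
  proof
    show "f \<in> borel_measurable lebesgue"
      by (rule measurable_completion) measurable
    show "integrable lebesgue (\<lambda>x. (cmod (f x))\<^sup>2)"
      using int by (subst integrable_completion) measurable
  qed
qed

text \<open>Completeness of the measure makes \<open>f\<close> measurable once it agrees with a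
  Borel function almost everywhere; integrals of Borel functions are unchanged by completion. Every
  Lebesgue integral of the statement is moved to \<open>lborel\<close> through these facts.\<close>

lemma lebesgue_integral_eq_lborel:
  fixes f f' :: "real \<Rightarrow> 'b::euclidean_space"
  assumes [measurable]: "f' \<in> borel_measurable borel" and AE: "AE x in lborel. f x = f' x"
  shows "f \<in> borel_measurable lebesgue" "integrable lebesgue f \<longleftrightarrow> integrable lborel f'"
    "integral\<^sup>L lebesgue f = integral\<^sup>L lborel f'"
proof -
  have f': "f' \<in> borel_measurable lborel" by simp
  have ae: "AE x in lebesgue. f' x = f x"
    using AE_completion[OF AE] by eventually_elim simp
  show f: "f \<in> borel_measurable lebesgue"
    using measurable_completion[OF f'] ae by (rule borel_measurable_AE)
  show "integrable lebesgue f \<longleftrightarrow> integrable lborel f'"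
    unfolding integrable_completion[OF f', symmetric]
    using f measurable_completion[OF f'] ae by (intro integrable_cong_AE) auto
  show "integral\<^sup>L lebesgue f = integral\<^sup>L lborel f'"
    unfolding integral_completion[OF f', symmetric]
    using f measurable_completion[OF f'] ae by (intro integral_cong_AE) auto
qed

lemma lebesgue_truncated_fourier:
  assumes f': "square_integrable lborel f'" and AE: "AE x in lborel. f x = f' x"
  shows "(LINT t:{-R..R}|lebesgue. f t * exp (- \<i> * complex_of_real (\<omega> * t)))
      = fourier (trunc R f') \<omega>"
proof -
  have [measurable]: "f' \<in> borel_measurable borel"
    using f' by (simp add: square_integrable_def)
  have ae: "AE t in lborel. indicator {-R..R} t *\<^sub>R (f t * exp (- \<i> * complex_of_real (\<omega> * t)))
     = trunc R f' t * exp (- \<i> * complex_of_real (\<omega> * t))"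
    using AE by eventually_elim (auto simp: trunc_def indicator_def)
  show ?thesis
    unfolding set_lebesgue_integral_def fourier_def
    by (rule lebesgue_integral_eq_lborel(3)[OF _ ae]) (unfold trunc_def, measurable)
qed

text \<open>Both functions enter the definition only through integrals, so Borel representatives may
  replace them. The extended-real distance then becomes a real squared norm.\<close>

lemma is_L2_fourier_iff:
  assumes f': "square_integrable lborel f'" and AE: "AE x in lborel. f x = f' x"
    and F': "square_integrable lborel F'" and AEF: "AE x in lborel. F x = F' x" and F: "L2 F"
  shows "is_L2_fourier f F \<longleftrightarrow> ((\<lambda>R. sq_norm lborel (\<lambda>\<omega>. fourier (trunc R f') \<omega> - F' \<omega>)) \<longlongrightarrow> 0) at_top"
proof -
  have "(\<integral>\<^sup>+\<omega>. ennreal ((cmod (F \<omega> -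
          (LINT t:{-R..R}|lebesgue. f t * exp (- \<i> * complex_of_real (\<omega> * t)))))\<^sup>2) \<partial>lebesgue)
     = ennreal (sq_norm lborel (\<lambda>\<omega>. fourier (trunc R f') \<omega> - F' \<omega>))" for R
  proof -
    have "(\<integral>\<^sup>+\<omega>. ennreal ((cmod (F \<omega> -
          (LINT t:{-R..R}|lebesgue. f t * exp (- \<i> * complex_of_real (\<omega> * t)))))\<^sup>2) \<partial>lebesgue)
      = (\<integral>\<^sup>+\<omega>. ennreal ((cmod (fourier (trunc R f') \<omega> - F' \<omega>))\<^sup>2) \<partial>lborel)"
      unfolding nn_integral_completion lebesgue_truncated_fourier[OF f' AE]
    proof (rule nn_integral_cong_AE)
      show "AE \<omega> in lborel. ennreal ((cmod (F \<omega> - fourier (trunc R f') \<omega>))\<^sup>2)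
          = ennreal ((cmod (fourier (trunc R f') \<omega> - F' \<omega>))\<^sup>2)"
        using AEF by eventually_elim (simp add: norm_minus_commute)
    qed
    then show ?thesis
      by (simp only: nn_integral_sq_norm[OF square_integrable_diff[OF Bessel_fourier(1)[OF
            integrable_trunc[OF f'] square_integrable_trunc[OF f']] F']])
  qed
  then show ?thesis
    using F unfolding is_L2_fourier_def
    by (simp add: tendsto_ennreal_iff[where x = 0, simplified])
qed

text \<open>Resolves the choice in \<open>L2_fourier\<close>: a limit in the mean exists, hence the
  chosen function is one too, and the limit property passes to its Borel representative.\<close>

lemma L2_fourier_representative:
  assumes "L2 f"
  obtains f' F' where "square_integrable lborel f'" "AE x in lborel. f x = f' x"
    "square_integrable lborel F'" "AE x in lborel. L2_fourier f x = F' x"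
    "((\<lambda>R. sq_norm lborel (\<lambda>\<omega>. fourier (trunc R f') \<omega> - F' \<omega>)) \<longlongrightarrow> 0) at_top"
proof -
  obtain f' where f': "square_integrable lborel f'" "AE x in lborel. f x = f' x"
    using L2_borel_representative[OF assms] .
  obtain E where "square_integrable lborel E"
    "((\<lambda>R. sq_norm lborel (\<lambda>\<omega>. fourier (trunc R f') \<omega> - E \<omega>)) \<longlongrightarrow> 0) at_top"
    using L2_fourier_limit_exists[OF f'(1)] .
  then have "is_L2_fourier f E"
    using is_L2_fourier_iff[OF f', of E E] square_integrable_lborel_imp_L2 by simp
  then have F: "is_L2_fourier f (L2_fourier f)"
    unfolding L2_fourier_def by (rule someI[of "is_L2_fourier f"])
  then have "L2 (L2_fourier f)"
    by (simp add: is_L2_fourier_def)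
  moreover obtain F' where "square_integrable lborel F'" "AE x in lborel. L2_fourier f x = F' x"
    using L2_borel_representative[OF \<open>L2 (L2_fourier f)\<close>] .
  ultimately show ?thesis
    using F is_L2_fourier_iff[OF f'] that[OF f'] by blast
qed

section \<open>Parseval's identity against translated and dilated functions\<close>

lemma square_integrable_affine:
  assumes f: "square_integrable lborel f" and c: "c \<noteq> 0"
  shows "square_integrable lborel (\<lambda>x. f (t + c * x))"
    "sq_norm lborel (\<lambda>x. f (t + c * x)) = sq_norm lborel f / \<bar>c\<bar>"
proof -
  have [measurable]: "f \<in> borel_measurable borel"
    using f by (simp add: square_integrable_def)
  show "square_integrable lborel (\<lambda>x. f (t + c * x))"
    using lborel_integrable_real_affine[OF _ c, of "\<lambda>x. (cmod (f x))\<^sup>2" t] f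
    by (auto simp: square_integrable_def)
  show "sq_norm lborel (\<lambda>x. f (t + c * x)) = sq_norm lborel f / \<bar>c\<bar>"
    using lborel_integral_real_affine[OF c, of "\<lambda>x. (cmod (f x))\<^sup>2" t] c by simp
qed

lemma fourier_affine:
  assumes "a \<noteq> 0"
  shows "fourier (\<lambda>t. f ((t - b) / a)) \<omega>
    = complex_of_real \<bar>a\<bar> * exp (- \<i> * complex_of_real (b * \<omega>)) * fourier f (a * \<omega>)"
proof -
  have "fourier (\<lambda>t. f ((t - b) / a)) \<omega>
     = \<bar>a\<bar> *\<^sub>R (LINT u|lborel. f ((b + a * u - b) / a) * exp (- \<i> * complex_of_real (\<omega> * (b
         + a * u))))"
    unfolding fourier_def by (rule lborel_integral_real_affine[OF assms])
  also have "(\<lambda>u. f ((b + a * u - b) / a) * exp (- \<i> * complex_of_real (\<omega> * (b + a * u))))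
     = (\<lambda>u. exp (- \<i> * complex_of_real (b * \<omega>)) * (f u * exp (- \<i> * complex_of_real (a * \<omega> * u))))"
    using assms by (simp add: fun_eq_iff algebra_simps flip: exp_add)
  finally show ?thesis
    by (simp add: fourier_def scaleR_conv_of_real)
qed

text \<open>Parseval's identity for truncations, followed by \<open>R\<close> tending to infinity on
  both sides. The right-hand side is the pointwise transform of an integrable product, which is what
  allows a further Parseval argument with \<open>b\<close> as the variable.\<close>

lemma Parseval_L2:
  assumes f: "square_integrable lborel f" and g: "square_integrable lborel g"
    and F: "square_integrable lborel F" "((\<lambda>R. sq_norm lborel (\<lambda>\<omega>. fourier (trunc R f) \<omega> - F \<omega>))
        \<longlongrightarrow> 0) at_top"
    and G: "square_integrable lborel G" "((\<lambda>R. sq_norm lborel (\<lambda>\<omega>. fourier (trunc R g) \<omega> - G \<omega>))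
        \<longlongrightarrow> 0) at_top"
    and a: "a \<noteq> 0"
  shows "(LINT t|lborel. f t * cnj (g ((t - b) / a)))
    = complex_of_real (\<bar>a\<bar> / (2 * pi)) * fourier (\<lambda>\<omega>. F \<omega> * cnj (G (a * \<omega>))) (- b)"
proof -
  let ?e = "\<lambda>\<omega>. complex_of_real \<bar>a\<bar> * exp (- \<i> * complex_of_real (b * \<omega>))"
  \<comment> \<open>Truncation precedes translation and dilation, so \<open>fourier_affine\<close>
    reduces the transform of \<open>?g R\<close> to that of \<open>trunc R g\<close>, whose limit is
    known.\<close>
  let ?g = "\<lambda>R t. trunc R g ((t - b) / a)"
  have aff: "(t - b) / a = - b / a + (1 / a) * t" for t
    by (simp add: field_simps diff_divide_distrib)
  have tr: "square_integrable lborel (?g R)" "integrable lborel (?g R)" for R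
    unfolding aff
    using square_integrable_affine(1)[OF square_integrable_trunc[OF g], of "1 / a" R "- b / a"]
      lborel_integrable_real_affine[OF integrable_trunc[OF g], of "1 / a" R "- b / a"] a by simp_all
  have lim1: "((\<lambda>R. LINT t|lborel. trunc R f t * cnj (?g R t))
      \<longlongrightarrow> (LINT t|lborel. f t * cnj (g ((t - b) / a)))) at_top"
  proof (rule tendsto_inner)
    show "((\<lambda>R. sq_norm lborel (\<lambda>t. trunc R f t - f t)) \<longlongrightarrow> 0) at_top"
      using trunc_tendsto[OF f] by (simp add: norm_minus_commute)
    show "square_integrable lborel (\<lambda>t. g ((t - b) / a))"
      unfolding aff using a by (intro square_integrable_affine g) auto
    have "sq_norm lborel (\<lambda>t. ?g R t - g ((t - b) / a))
        = sq_norm lborel (\<lambda>t. g t - trunc R g t) * \<bar>a\<bar>" for R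
      unfolding aff
      using square_integrable_affine(2)[OF square_integrable_diff[OF g square_integrable_trunc[OF
          g]], of "1 / a" "- b / a" R] a
      by (simp add: norm_minus_commute)
    then show "((\<lambda>R. sq_norm lborel (\<lambda>t. ?g R t - g ((t - b) / a))) \<longlongrightarrow> 0) at_top"
      using tendsto_mult_left_zero[OF trunc_tendsto[OF g]] by simp
  qed (use f g tr square_integrable_trunc in auto)
  have e: "?e \<in> borel_measurable lborel" "cmod (?e \<omega>) \<le> \<bar>a\<bar>" for \<omega>
    by (measurable, simp add: norm_mult)
  have \<Phi>: "square_integrable lborel (fourier (trunc R g))" for R
    by (intro Bessel_fourier integrable_trunc square_integrable_trunc g)
  have lim2: "((\<lambda>R. LINT \<omega>|lborel. fourier (trunc R f) \<omega> * cnj (?e \<omega> * fourier (trunc R g) (a * \<omega>)))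
      \<longlongrightarrow> (LINT \<omega>|lborel. F \<omega> * cnj (?e \<omega> * G (a * \<omega>)))) at_top"
  proof (rule tendsto_inner[OF _ F(1) _ _ F(2)])
    have "sq_norm lborel (\<lambda>\<omega>. ?e \<omega> * fourier (trunc R g) (a * \<omega>) - ?e \<omega> * G (a * \<omega>))
       = \<bar>a\<bar> * sq_norm lborel (\<lambda>\<omega>. fourier (trunc R g) \<omega> - G \<omega>)" for R
    proof -
      have "sq_norm lborel (\<lambda>\<omega>. ?e \<omega> * fourier (trunc R g) (a * \<omega>) - ?e \<omega> * G (a * \<omega>))
        = (LINT \<omega>|lborel. \<bar>a\<bar>\<^sup>2 * (cmod (fourier (trunc R g) (0 + a * \<omega>) - G (0 + a * \<omega>)))\<^sup>2)"
        unfolding right_diff_distrib[symmetric] by (simp add: norm_mult power_mult_distrib)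
      also have "\<dots> = \<bar>a\<bar>\<^sup>2 * (sq_norm lborel (\<lambda>\<omega>. fourier (trunc R g) \<omega> - G \<omega>) / \<bar>a\<bar>)"
        using square_integrable_affine(2)[OF square_integrable_diff[OF \<Phi> G(1)] a, of R 0] by simp
      also have "\<dots> = \<bar>a\<bar> * sq_norm lborel (\<lambda>\<omega>. fourier (trunc R g) \<omega> - G \<omega>)"
      proof -
        have "x\<^sup>2 * (S / x) = x * S" for x S :: real
          by (cases "x = 0") (simp_all add: power2_eq_square)
        then show ?thesis .
      qed
      finally show ?thesis .
    qed
    then show "((\<lambda>R. sq_norm lborel (\<lambda>\<omega>. ?e \<omega> * fourier (trunc R g) (a * \<omega>) - ?e \<omega> * G (a * \<omega>)))
        \<longlongrightarrow> 0) at_top"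
      using tendsto_mult_right_zero[OF G(2)] by simp
    show "square_integrable lborel (fourier (trunc R f))" for R
      by (intro Bessel_fourier integrable_trunc square_integrable_trunc f)
    show "square_integrable lborel (\<lambda>\<omega>. ?e \<omega> * fourier (trunc R g) (a * \<omega>))" for R
      using square_integrable_affine(1)[OF \<Phi> a, of R 0] e by (intro square_integrable_cmult) auto
    show "square_integrable lborel (\<lambda>\<omega>. ?e \<omega> * G (a * \<omega>))"
      using square_integrable_affine(1)[OF G(1) a, of 0] e by (intro square_integrable_cmult) auto
  qed
  have "(LINT \<omega>|lborel. fourier (trunc R f) \<omega> * cnj (?e \<omega> * fourier (trunc R g) (a * \<omega>)))
     = 2 * pi * (LINT t|lborel. trunc R f t * cnj (?g R t))" for R
    unfolding fourier_affine[OF a, symmetric]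
    by (intro Parseval_fourier integrable_trunc square_integrable_trunc f tr)
  with lim2 have "((\<lambda>R. 2 * pi * (LINT t|lborel. trunc R f t * cnj (?g R t)))
      \<longlongrightarrow> (LINT \<omega>|lborel. F \<omega> * cnj (?e \<omega> * G (a * \<omega>)))) at_top"
    by simp
  moreover have "((\<lambda>R. 2 * pi * (LINT t|lborel. trunc R f t * cnj (?g R t)))
      \<longlongrightarrow> 2 * pi * (LINT t|lborel. f t * cnj (g ((t - b) / a)))) at_top"
    by (intro tendsto_mult tendsto_const lim1)
  ultimately have "2 * pi * (LINT t|lborel. f t * cnj (g ((t - b) / a)))
      = (LINT \<omega>|lborel. F \<omega> * cnj (?e \<omega> * G (a * \<omega>)))"
    by (intro tendsto_unique[OF trivial_limit_at_top_linorder])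
  also have "\<dots> = (LINT \<omega>|lborel. complex_of_real \<bar>a\<bar> * ((F \<omega> * cnj (G (a * \<omega>))) * exp (- \<i>
      * complex_of_real (- b * \<omega>))))"
    by (intro Bochner_Integration.integral_cong refl) (simp add: exp_cnj mult_ac)
  also have "\<dots> = complex_of_real \<bar>a\<bar> * fourier (\<lambda>\<omega>. F \<omega> * cnj (G (a * \<omega>))) (- b)"
    by (simp only: fourier_def integral_mult_right_zero)
  finally show ?thesis
    by (simp add: field_simps)
qed

section \<open>Orthogonality of the wavelet transform\<close>

lemma AE_lborel_nonzero: "AE x::real in lborel. x \<noteq> 0"
  by (rule AE_lborel_singleton)

text \<open>Substitution \<open>u = \<omega> * a\<close>: the measure
  \<open>da / \<bar>a\<bar>\<close> is Haar measure on the nonzero reals under multiplication. This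
  extended version serves to prove joint integrability; the Bochner version below evaluates the
  integral.\<close>

lemma nn_integral_scale_invariant:
  fixes q :: "real \<Rightarrow> real"
  assumes [measurable]: "q \<in> borel_measurable borel" and q: "\<And>u. q u \<ge> 0" and \<omega>: "\<omega> \<noteq> 0"
  shows "(\<integral>\<^sup>+a. ennreal (q (a * \<omega>) / \<bar>a\<bar>) \<partial>lborel) = (\<integral>\<^sup>+u. ennreal (q u / \<bar>u\<bar>) \<partial>lborel)"
proof -
  have "(\<integral>\<^sup>+u. ennreal (q u / \<bar>u\<bar>) \<partial>lborel) = ennreal \<bar>\<omega>\<bar> * (\<integral>\<^sup>+a. ennreal (q (0 + \<omega> * a) / \<bar>0
      + \<omega> * a\<bar>) \<partial>lborel)"
    by (rule nn_integral_real_affine) (measurable, rule \<omega>)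
  also have "\<dots> = (\<integral>\<^sup>+a. ennreal \<bar>\<omega>\<bar> * ennreal (q (0 + \<omega> * a) / \<bar>0 + \<omega> * a\<bar>) \<partial>lborel)"
    by (rule nn_integral_cmult[symmetric]) measurable
  also have "\<dots> = (\<integral>\<^sup>+a. ennreal (q (a * \<omega>) / \<bar>a\<bar>) \<partial>lborel)"
    using \<omega> q by (intro nn_integral_cong) (simp add: abs_mult mult.commute flip: ennreal_mult)
  finally show ?thesis ..
qed

lemma integral_scale_invariant:
  fixes q :: "real \<Rightarrow> real"
  assumes \<omega>: "\<omega> \<noteq> 0"
  shows "(LINT a|lborel. q (a * \<omega>) / \<bar>a\<bar>) = (LINT u|lborel. q u / \<bar>u\<bar>)"
proof -
  have "(LINT u|lborel. q u / \<bar>u\<bar>) = \<bar>\<omega>\<bar> *\<^sub>R (LINT a|lborel. q (0 + \<omega> * a) / \<bar>0 + \<omega> * a\<bar>)"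
    by (rule lborel_integral_real_affine[OF \<omega>])
  also have "\<dots> = (LINT a|lborel. \<bar>\<omega>\<bar> * (q (0 + \<omega> * a) / \<bar>0 + \<omega> * a\<bar>))"
    by (simp only: real_scaleR_def integral_mult_right_zero)
  also have "\<dots> = (LINT a|lborel. q (a * \<omega>) / \<bar>a\<bar>)"
    using \<omega> by (intro Bochner_Integration.integral_cong refl) (simp add: abs_mult mult.commute)
  finally show ?thesis ..
qed

text \<open>Integrating over \<open>a\<close> first, scale invariance turns the dilated factor into
  a constant and leaves the integral of \<open>Z\<close>. Tonelli therefore gives joint
  integrability, and Fubini the three conclusions. It is applied with \<open>q\<close> the squared
  modulus of the wavelet's transform.\<close>

lemma dilation_Fubini:
  fixes q :: "real \<Rightarrow> real" and Z :: "real \<Rightarrow> complex"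
  assumes Z: "integrable lborel Z"
    and q[measurable]: "q \<in> borel_measurable borel" and nn: "\<And>u. q u \<ge> 0"
        and int: "integrable lborel (\<lambda>u. q u / \<bar>u\<bar>)"
  defines "K \<equiv> \<lambda>a \<omega>. Z \<omega> * complex_of_real (q (a * \<omega>) / \<bar>a\<bar>)"
  shows "AE a in lborel. integrable lborel (K a)"
    and "integrable lborel (\<lambda>a. LINT \<omega>|lborel. K a \<omega>)"
    and "(LINT a|lborel. LINT \<omega>|lborel. K a \<omega>) = (LINT u|lborel. q u / \<bar>u\<bar>) * (LINT \<omega>|lborel. Z \<omega>)"
proof -
  have [measurable]: "Z \<in> borel_measurable borel"
    using Z by (auto dest: borel_measurable_integrable)
  let ?C = "LINT u|lborel. q u / \<bar>u\<bar>"
  have C: "(\<integral>\<^sup>+u. ennreal (q u / \<bar>u\<bar>) \<partial>lborel) = ennreal ?C"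
    using int nn by (intro nn_integral_eq_integral) auto
  have K: "integrable (lborel \<Otimes>\<^sub>M lborel) (case_prod K)"
  proof (rule integrableI_bounded)
    show "case_prod K \<in> borel_measurable (lborel \<Otimes>\<^sub>M lborel)"
      unfolding K_def by measurable
    have "(\<integral>\<^sup>+p. ennreal (norm (case_prod K p)) \<partial>(lborel \<Otimes>\<^sub>M lborel))
       = (\<integral>\<^sup>+\<omega>. \<integral>\<^sup>+a. ennreal (cmod (Z \<omega>)) * ennreal (q (a * \<omega>) / \<bar>a\<bar>) \<partial>lborel \<partial>lborel)"
    proof -
      have "ennreal (norm (K a \<omega>)) = ennreal (cmod (Z \<omega>)) * ennreal (q (a * \<omega>) / \<bar>a\<bar>)" for a \<omega>
        unfolding K_def norm_mult norm_of_real using nn by (subst ennreal_mult) auto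
      moreover have "(\<lambda>p. ennreal (norm (case_prod K p))) \<in> borel_measurable (lborel \<Otimes>\<^sub>M lborel)"
        unfolding K_def by measurable
      ultimately show ?thesis
        using lborel_pair.nn_integral_snd[of "\<lambda>p. ennreal (norm (case_prod K p))"] by simp
    qed
    also have "\<dots> = (\<integral>\<^sup>+\<omega>. ennreal (cmod (Z \<omega>)) * ennreal ?C \<partial>lborel)"
    proof (rule nn_integral_cong_AE)
      \<comment> \<open>The substitution breaks down at \<open>\<omega> = 0\<close>, a null
        set.\<close>
      show "AE \<omega> in lborel. (\<integral>\<^sup>+a. ennreal (cmod (Z \<omega>)) * ennreal (q (a * \<omega>) / \<bar>a\<bar>) \<partial>lborel)
         = ennreal (cmod (Z \<omega>)) * ennreal ?C"
        using AE_lborel_nonzero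
        by eventually_elim (simp add: nn_integral_cmult nn_integral_scale_invariant nn C)
    qed
    also have "\<dots> = ennreal (LINT \<omega>|lborel. cmod (Z \<omega>)) * ennreal ?C"
      using Z by (simp add: nn_integral_multc nn_integral_eq_integral)
    also have "\<dots> < \<infinity>"
      by (simp add: ennreal_mult_less_top)
    finally show "(\<integral>\<^sup>+p. ennreal (norm (case_prod K p)) \<partial>(lborel \<Otimes>\<^sub>M lborel)) < \<infinity>" .
  qed
  show "AE a in lborel. integrable lborel (K a)"
    using lborel_pair.AE_integrable_fst'[OF K] by simp
  show "integrable lborel (\<lambda>a. LINT \<omega>|lborel. K a \<omega>)"
    using lborel_pair.integrable_fst'[OF K] by simp
  have "(LINT a|lborel. LINT \<omega>|lborel. K a \<omega>) = (LINT \<omega>|lborel. LINT a|lborel. K a \<omega>)"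
    by (rule lborel_pair.Fubini_integral[OF K, symmetric])
  also have "\<dots> = (LINT \<omega>|lborel. Z \<omega> * complex_of_real ?C)"
  proof (rule integral_cong_AE)
    show "(\<lambda>\<omega>. LINT a|lborel. K a \<omega>) \<in> borel_measurable lborel"
      unfolding K_def by measurable
    show "AE \<omega> in lborel. (LINT a|lborel. K a \<omega>) = Z \<omega> * complex_of_real ?C"
      using AE_lborel_nonzero
    proof eventually_elim
      case (elim \<omega>)
      have "(LINT a|lborel. K a \<omega>) = Z \<omega> * complex_of_real (LINT a|lborel. q (a * \<omega>) / \<bar>a\<bar>)"
        unfolding K_def by (simp only: integral_mult_right_zero integral_complex_of_real)
      then show ?case
        by (simp only: integral_scale_invariant[OF elim])
    qed
  qed measurable
  finally show "(LINT a|lborel. LINT \<omega>|lborel. K a \<omega>) = ?C * (LINT \<omega>|lborel. Z \<omega>)"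
    by (simp add: mult.commute)
qed

text \<open>For fixed \<open>a\<close> the product \<open>X \<omega> * cnj (F (a * \<omega>))\<close> is only integrable; the square
  integrability needed for Parseval's identity is available for almost every \<open>a\<close>.\<close>

lemma coefficient_inner:
  assumes a: "a \<noteq> 0"
    and F: "square_integrable lborel F" and X: "square_integrable lborel X"
        and Y: "square_integrable lborel Y"
    and XF: "square_integrable lborel (\<lambda>\<omega>. X \<omega> * cnj (F (a * \<omega>)))"
    and YF: "square_integrable lborel (\<lambda>\<omega>. Y \<omega> * cnj (F (a * \<omega>)))"
    and U: "\<And>b. U b = complex_of_real (\<bar>a\<bar> / (2 * pi)) * fourier (\<lambda>\<omega>. X \<omega> * cnj (F (a * \<omega>))) (- b)"
    and V: "\<And>b. V b = complex_of_real (\<bar>a\<bar> / (2 * pi)) * fourier (\<lambda>\<omega>. Y \<omega> * cnj (F (a * \<omega>))) (- b)"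
  shows "integrable lborel (\<lambda>b. U b * cnj (V b))"
    and "(LINT b|lborel. U b * cnj (V b))
      = complex_of_real (\<bar>a\<bar>\<^sup>2 / (2 * pi)) * (LINT \<omega>|lborel. X \<omega> * cnj (Y \<omega>) * complex_of_real
          ((cmod (F (a * \<omega>)))\<^sup>2))"
proof -
  let ?P = "\<lambda>\<omega>. X \<omega> * cnj (F (a * \<omega>))" and ?Q = "\<lambda>\<omega>. Y \<omega> * cnj (F (a * \<omega>))"
  let ?c = "complex_of_real (\<bar>a\<bar> / (2 * pi))"
  have Fa: "square_integrable lborel (\<lambda>\<omega>. F (a * \<omega>))"
    using square_integrable_affine(1)[OF F a, of 0] by simp
  have P: "integrable lborel ?P" and Q: "integrable lborel ?Q"
    by (intro square_integrable_integrable_mult X Y Fa)+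
  let ?I = "\<lambda>\<omega>. fourier ?P \<omega> * cnj (fourier ?Q \<omega>)"
  have int: "integrable lborel ?I"
    by (intro square_integrable_integrable_mult Bessel_fourier P Q XF YF)
  \<comment> \<open>The coefficients are transforms taken at \<open>- b\<close>; reflection removes
    the sign without changing the integral.\<close>
  have int': "integrable lborel (\<lambda>b. ?I (- b))"
    using lborel_integrable_real_affine[OF int, of "-1" 0] by simp
  have UV: "U b * cnj (V b) = complex_of_real ((\<bar>a\<bar> / (2 * pi))\<^sup>2) * ?I (- b)" for b
    by (simp only: U V complex_cnj_mult complex_cnj_complex_of_real power2_eq_square of_real_mult
        mult_ac)
  show "integrable lborel (\<lambda>b. U b * cnj (V b))"
    unfolding UV by (intro integrable_mult_right int')
  have "(LINT b|lborel. U b * cnj (V b)) = complex_of_real ((\<bar>a\<bar> / (2 * pi))\<^sup>2) * (LINT b|lborel. ?I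
      (- b))"
    unfolding UV by (rule integral_mult_right_zero)
  also have "(LINT b|lborel. ?I (- b)) = (LINT b|lborel. ?I b)"
    using lborel_integral_real_affine[of "-1" ?I 0] by simp
  also have "\<dots> = 2 * pi * (LINT \<omega>|lborel. ?P \<omega> * cnj (?Q \<omega>))"
    by (rule Parseval_fourier[OF P XF Q YF])
  also have "(LINT \<omega>|lborel. ?P \<omega> * cnj (?Q \<omega>))
      = (LINT \<omega>|lborel. X \<omega> * cnj (Y \<omega>) * complex_of_real ((cmod (F (a * \<omega>)))\<^sup>2))"
    by (simp only: complex_norm_square complex_cnj_mult complex_cnj_cnj mult_ac)
  \<comment> \<open>Each coefficient brings a factor \<open>\<bar>a\<bar> / (2 * pi)\<close>, and
    Parseval in \<open>b\<close> cancels one of the two factors \<open>2 * pi\<close> in the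
    denominator.\<close>
  also have "complex_of_real ((\<bar>a\<bar> / (2 * pi))\<^sup>2) * (2 * pi * (LINT \<omega>|lborel. X \<omega> * cnj (Y \<omega>)
      * complex_of_real ((cmod (F (a * \<omega>)))\<^sup>2)))
     = complex_of_real (\<bar>a\<bar>\<^sup>2 / (2 * pi)) * (LINT \<omega>|lborel. X \<omega> * cnj (Y \<omega>) * complex_of_real ((cmod
         (F (a * \<omega>)))\<^sup>2))"
    by (simp add: field_simps power2_eq_square)
  finally show "(LINT b|lborel. U b * cnj (V b))
      = complex_of_real (\<bar>a\<bar>\<^sup>2 / (2 * pi)) * (LINT \<omega>|lborel. X \<omega> * cnj (Y \<omega>) * complex_of_real
          ((cmod (F (a * \<omega>)))\<^sup>2))" .
qed

text \<open>The first conclusion of \<open>dilation_Fubini\<close> with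
  \<open>Z = X * cnj X\<close>; multiplying by \<open>\<bar>a\<bar>\<close> undoes the division by
  it. Finiteness of the admissibility integral is used here.\<close>

lemma AE_square_integrable_dilated_product:
  assumes X: "square_integrable lborel X" and F: "square_integrable lborel F"
    and adm: "integrable lborel (\<lambda>u. (cmod (F u))\<^sup>2 / \<bar>u\<bar>)"
  shows "AE a in lborel. square_integrable lborel (\<lambda>\<omega>. X \<omega> * cnj (F (a * \<omega>)))"
proof -
  have [measurable]: "X \<in> borel_measurable borel" "F \<in> borel_measurable borel"
    using X F by (auto simp: square_integrable_def)
  have "AE a in lborel. integrable lborel (\<lambda>\<omega>. X \<omega> * cnj (X \<omega>) * complex_of_real ((cmod (F (a
      * \<omega>)))\<^sup>2 / \<bar>a\<bar>))"
    by (rule dilation_Fubini(1)[OF square_integrable_integrable_mult[OF X X] _ _ adm]) auto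
  with AE_lborel_nonzero show ?thesis
  proof eventually_elim
    case (elim a)
    have "integrable lborel (\<lambda>\<omega>. \<bar>a\<bar> * cmod (X \<omega> * cnj (X \<omega>) * complex_of_real ((cmod (F (a
        * \<omega>)))\<^sup>2 / \<bar>a\<bar>)))"
      by (intro integrable_mult_right integrable_norm elim)
    then show ?case
    proof (rule square_integrable_bound)
      show "(cmod (X \<omega> * cnj (F (a * \<omega>))))\<^sup>2
          \<le> \<bar>a\<bar> * cmod (X \<omega> * cnj (X \<omega>) * complex_of_real ((cmod (F (a * \<omega>)))\<^sup>2 / \<bar>a\<bar>))" for \<omega>
        using elim by (simp add: norm_mult norm_divide power_mult_distrib power2_eq_square)
    qed measurable
  qed
qed

text \<open>The exponent involves \<open>t\<^sup>2 - b\<^sup>2\<close>, so the chirp splits into a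
  factor in \<open>t\<close>, attached to the signal, and a factor in \<open>b\<close>, which leaves
  the integral. Borel representatives are substituted at the same time.\<close>

lemma GNFrWT_eq_unchirped:
  assumes \<phi>': "square_integrable lborel \<phi>'" and AE\<phi>: "AE x in lborel. \<phi> x = \<phi>' x"
    and h': "square_integrable lborel h'" and AEh: "AE x in lborel. h x = h' x" and a: "a \<noteq> 0"
  shows "GNFrWT \<alpha> \<rho> \<phi> h a b
    = complex_of_real (\<bar>a\<bar> powr - \<rho>) * exp (- \<i> * complex_of_real (b\<^sup>2 * cot (\<alpha> * pi / 2) / 2))
      * (LINT t|lborel. (exp (\<i> * complex_of_real (t\<^sup>2 * cot (\<alpha> * pi / 2) / 2)) * h' t) * cnj (\<phi>'
          ((t - b) / a)))"
proof -
  have [measurable]: "\<phi>' \<in> borel_measurable borel" "h' \<in> borel_measurable borel"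
    using \<phi>' h' by (auto simp: square_integrable_def)
  let ?k = "cot (\<alpha> * pi / 2)"
  let ?c = "complex_of_real (\<bar>a\<bar> powr - \<rho>) * exp (- \<i> * complex_of_real (b\<^sup>2 * ?k / 2))"
  let ?f = "\<lambda>t. ?c * ((exp (\<i> * complex_of_real (t\<^sup>2 * ?k / 2)) * h' t) * cnj (\<phi>' ((t - b) / a)))"
  obtain N where N: "N \<in> null_sets lborel" "\<And>x. x \<notin> N \<Longrightarrow> \<phi> x = \<phi>' x"
    using AE\<phi> unfolding eventually_ae_filter by auto
  have [measurable]: "N \<in> sets borel"
    using N(1) by auto
  \<comment> \<open>The preimage of a null set under an invertible affine map is null, so agreement
    of \<open>\<phi>\<close> and \<open>\<phi>'\<close> almost everywhere survives translation and
    dilation.\<close>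
  have "AE x in lborel. - b / a + 1 / a * x \<notin> N"
    using N(1) a by (intro AE_borel_affine AE_not_in) auto
  then have "AE t in lborel. \<phi> ((t - b) / a) = \<phi>' ((t - b) / a)"
    by eventually_elim (auto intro!: N(2) simp: diff_divide_distrib)
  then have AE: "AE t in lborel. h t * cnj (frac_wavelet \<alpha> \<rho> \<phi> a b t) = ?f t"
    using AEh
  proof eventually_elim
    case (elim t)
    have "cnj (exp (- (\<i> / 2) * complex_of_real ((t\<^sup>2 - b\<^sup>2) * ?k)))
        = exp (- \<i> * complex_of_real (b\<^sup>2 * ?k / 2) + \<i> * complex_of_real (t\<^sup>2 * ?k / 2))"
      by (simp add: exp_cnj algebra_simps diff_divide_distrib)
    then show ?case
      using elim by (simp only: frac_wavelet_def complex_cnj_mult complex_cnj_complex_of_real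
          exp_add mult_ac)
  qed
  have "GNFrWT \<alpha> \<rho> \<phi> h a b = (LINT t|lborel. ?f t)"
    unfolding GNFrWT_def by (rule lebesgue_integral_eq_lborel(3)[OF _ AE]) measurable
  then show ?thesis
    by (simp only: integral_mult_right_zero)
qed

text \<open>The Bochner integral of a non-integrable function is 0 by convention, so the equation
  alone would not express convergence. The first two conjuncts assert that the inner and the outer
  integral are genuine.\<close>

theorem theorem1p1:
  fixes \<alpha> \<rho> :: real and \<phi> h g :: "real \<Rightarrow> complex"
  assumes "sin (\<alpha> * pi / 2) \<noteq> 0" and "\<rho> \<ge> 0"
    and "wavelet \<phi>" and "L2 h" and "L2 g"
  defines "W \<equiv> GNFrWT \<alpha> \<rho> \<phi>"
  shows "(AE a in lebesgue. integrable lebesgue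
            (\<lambda>b. W h a b * cnj (W g a b) * complex_of_real (\<bar>a\<bar> powr (2 * \<rho> - 3))))
       \<and> integrable lebesgue (\<lambda>a. LINT b|lebesgue.
            W h a b * cnj (W g a b) * complex_of_real (\<bar>a\<bar> powr (2 * \<rho> - 3)))
       \<and> (LINT a|lebesgue. LINT b|lebesgue.
            W h a b * cnj (W g a b) * complex_of_real (\<bar>a\<bar> powr (2 * \<rho> - 3)))
         = complex_of_real (admissibility_const \<phi>) * L2_inner h g"
proof -
  have "L2 \<phi>" and adm: "integrable lebesgue (\<lambda>\<omega>. (cmod (L2_fourier \<phi> \<omega>))\<^sup>2 / \<bar>\<omega>\<bar>)"
    using assms(3) by (auto simp: wavelet_def)
  obtain \<phi>' F where \<phi>': "square_integrable lborel \<phi>'" "AE x in lborel. \<phi> x = \<phi>' x"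
    and F: "square_integrable lborel F" and AEF: "AE x in lborel. L2_fourier \<phi> x = F x"
    and limF: "((\<lambda>R. sq_norm lborel (\<lambda>\<omega>. fourier (trunc R \<phi>') \<omega> - F \<omega>)) \<longlongrightarrow> 0) at_top"
    by (rule L2_fourier_representative[OF \<open>L2 \<phi>\<close>])
  obtain h' where h': "square_integrable lborel h'" "AE x in lborel. h x = h' x"
    by (rule L2_borel_representative[OF \<open>L2 h\<close>])
  obtain g' where g': "square_integrable lborel g'" "AE x in lborel. g x = g' x"
    by (rule L2_borel_representative[OF \<open>L2 g\<close>])
  have [measurable]: "F \<in> borel_measurable borel" "h' \<in> borel_measurable borel"
      "g' \<in> borel_measurable borel"
    using F h' g' by (auto simp: square_integrable_def)
  let ?k = "cot (\<alpha> * pi / 2)"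
  let ?e = "\<lambda>t. exp (\<i> * complex_of_real (t\<^sup>2 * ?k / 2))"
  define H where "H = (\<lambda>t. ?e t * h' t)"
  define G where "G = (\<lambda>t. ?e t * g' t)"
  have e_measurable: "?e \<in> borel_measurable lborel"
    by measurable
  have e_le: "cmod (?e t) \<le> 1" for t
    by simp
  have H: "square_integrable lborel H" and G: "square_integrable lborel G"
    unfolding H_def G_def by (intro square_integrable_cmult[OF _ e_measurable e_le] h' g')+
  obtain X where X: "square_integrable lborel X"
    and limX: "((\<lambda>R. sq_norm lborel (\<lambda>\<omega>. fourier (trunc R H) \<omega> - X \<omega>)) \<longlongrightarrow> 0) at_top"
    by (rule L2_fourier_limit_exists[OF H])
  obtain Y where Y: "square_integrable lborel Y"
    and limY: "((\<lambda>R. sq_norm lborel (\<lambda>\<omega>. fourier (trunc R G) \<omega> - Y \<omega>)) \<longlongrightarrow> 0) at_top"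
    by (rule L2_fourier_limit_exists[OF G])
  \<comment> \<open>The admissibility integral depends on \<open>L2_fourier \<phi>\<close> only up
    to null sets, so \<open>F\<close> may stand in for it.\<close>
  have AEadm: "AE \<omega> in lborel. (cmod (L2_fourier \<phi> \<omega>))\<^sup>2 / \<bar>\<omega>\<bar> = (cmod (F \<omega>))\<^sup>2 / \<bar>\<omega>\<bar>"
    using AEF by eventually_elim simp
  have adm': "integrable lborel (\<lambda>\<omega>. (cmod (F \<omega>))\<^sup>2 / \<bar>\<omega>\<bar>)"
    using adm by (subst lebesgue_integral_eq_lborel(2)[OF _ AEadm, symmetric]) measurable
  have C: "(LINT \<omega>|lborel. (cmod (F \<omega>))\<^sup>2 / \<bar>\<omega>\<bar>) = admissibility_const \<phi>"
    unfolding admissibility_const_def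
    by (rule lebesgue_integral_eq_lborel(3)[OF _ AEadm, symmetric]) measurable
  have XY: "(LINT \<omega>|lborel. X \<omega> * cnj (Y \<omega>)) = 2 * pi * L2_inner h g"
  proof -
    have "AE t in lborel. h t * cnj (g t) = h' t * cnj (g' t)"
      using h'(2) g'(2) by eventually_elim simp
    then have "L2_inner h g = (LINT t|lborel. h' t * cnj (g' t))"
      unfolding L2_inner_def by (rule lebesgue_integral_eq_lborel(3)[rotated]) measurable
    \<comment> \<open>The chirps cancel because they are unimodular and common to both signals. The
      form \<open>(t - 0) / 1\<close> fits \<open>Parseval_L2\<close> with scale 1 and shift 0,
      which serves as the plain Parseval identity.\<close>
    also have "\<dots> = (LINT t|lborel. H t * cnj (G ((t - 0) / 1)))"
    proof (intro Bochner_Integration.integral_cong refl)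
      fix t
      have "?e t * cnj (?e t) = 1"
        by (simp add: complex_norm_square[symmetric] del: exp_cnj)
      then show "h' t * cnj (g' t) = H t * cnj (G ((t - 0) / 1))"
        by (simp add: H_def G_def mult_ac)
    qed
    also have "\<dots> = complex_of_real (1 / (2 * pi)) * (LINT \<omega>|lborel. X \<omega> * cnj (Y \<omega>))"
      using Parseval_L2[OF H G X limX Y limY, of 1 0] by (simp add: fourier_def)
    finally show ?thesis by simp
  qed
  define U where "U = (\<lambda>a b. LINT t|lborel. H t * cnj (\<phi>' ((t - b) / a)))"
  define V where "V = (\<lambda>a b. LINT t|lborel. G t * cnj (\<phi>' ((t - b) / a)))"
  define K where "K = (\<lambda>a \<omega>. X \<omega> * cnj (Y \<omega>) * complex_of_real ((cmod (F (a * \<omega>)))\<^sup>2 / \<bar>a\<bar>))"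
  have K: "integrable lborel (\<lambda>a. LINT \<omega>|lborel. K a \<omega>)"
    "(LINT a|lborel. LINT \<omega>|lborel. K a \<omega>) = admissibility_const \<phi> * (2 * pi * L2_inner h g)"
    unfolding K_def XY[symmetric] C[symmetric]
    by (rule dilation_Fubini(2,3)[OF square_integrable_integrable_mult[OF X Y] _ _ adm']; simp)+
  let ?I = "\<lambda>a b. W h a b * cnj (W g a b) * complex_of_real (\<bar>a\<bar> powr (2 * \<rho> - 3))"
  \<comment> \<open>The unimodular factors in \<open>b\<close> cancel, and the exponents
    \<open>- \<rho>\<close>, \<open>- \<rho>\<close> and \<open>2 * \<rho> - 3\<close> add up to
    \<open>- 3\<close>.\<close>
  have I: "?I a b = complex_of_real (1 / \<bar>a\<bar> ^ 3) * (U a b * cnj (V a b))" if a: "a \<noteq> 0" for a b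
  proof -
    let ?p = "complex_of_real (\<bar>a\<bar> powr - \<rho>)" and ?c = "exp (- \<i> * complex_of_real (b\<^sup>2 * ?k / 2))"
    have "W h a b = ?p * ?c * U a b" "W g a b = ?p * ?c * V a b"
      unfolding W_def U_def V_def H_def G_def
      by (rule GNFrWT_eq_unchirped[OF \<phi>' h' a], rule GNFrWT_eq_unchirped[OF \<phi>' g' a])
    then have "?I a b = (?p * ?p * complex_of_real (\<bar>a\<bar> powr (2 * \<rho> - 3))) * (?c * cnj ?c) * (U a b
        * cnj (V a b))"
      by (simp only: complex_cnj_mult complex_cnj_complex_of_real mult_ac)
    also have "?c * cnj ?c = 1"
      by (simp add: complex_norm_square[symmetric] del: exp_cnj)
    also have "?p * ?p * complex_of_real (\<bar>a\<bar> powr (2 * \<rho> - 3))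
        = complex_of_real (\<bar>a\<bar> powr (- \<rho> + - \<rho> + (2 * \<rho> - 3)))"
      by (simp only: powr_add of_real_mult)
    also have "\<bar>a\<bar> powr (- \<rho> + - \<rho> + (2 * \<rho> - 3)) = 1 / \<bar>a\<bar> ^ 3"
      using a by (simp add: powr_minus_divide powr_numeral)
    finally show ?thesis by simp
  qed
  have inner: "integrable lebesgue (?I a) \<and> (LINT b|lebesgue. ?I a b)
      = complex_of_real (1 / (2 * pi)) * (LINT \<omega>|lborel. K a \<omega>)"
    if a: "a \<noteq> 0" and XF: "square_integrable lborel (\<lambda>\<omega>. X \<omega> * cnj (F (a * \<omega>)))"
      and YF: "square_integrable lborel (\<lambda>\<omega>. Y \<omega> * cnj (F (a * \<omega>)))" for a
  proof -
    let ?J = "\<lambda>b. complex_of_real (1 / \<bar>a\<bar> ^ 3) * (U a b * cnj (V a b))"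
    have "U a b = complex_of_real (\<bar>a\<bar> / (2 * pi)) * fourier (\<lambda>\<omega>. X \<omega> * cnj (F (a * \<omega>))) (- b)"
      "V a b = complex_of_real (\<bar>a\<bar> / (2 * pi)) * fourier (\<lambda>\<omega>. Y \<omega> * cnj (F (a * \<omega>))) (- b)" for b
      unfolding U_def V_def
      by (rule Parseval_L2[OF H \<phi>'(1) X limX F limF a],
          rule Parseval_L2[OF G \<phi>'(1) Y limY F limF a])
    note UV = coefficient_inner[OF a F X Y XF YF this]
    have J: "integrable lborel ?J"
      by (intro integrable_mult_right UV)
    then have [measurable]: "?J \<in> borel_measurable borel"
      by (auto dest: borel_measurable_integrable)
    have AE: "AE b in lborel. ?I a b = ?J b"
      using I[OF a] by simp
    have "(LINT b|lborel. ?J b) = complex_of_real (1 / \<bar>a\<bar> ^ 3) * (complex_of_real (\<bar>a\<bar>\<^sup>2 / (2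
        * pi)) *
        (LINT \<omega>|lborel. X \<omega> * cnj (Y \<omega>) * complex_of_real ((cmod (F (a * \<omega>)))\<^sup>2)))"
      by (simp only: integral_mult_right_zero UV)
    also have "\<dots> = complex_of_real (1 / (2 * pi)) * (complex_of_real (1 / \<bar>a\<bar>) *
        (LINT \<omega>|lborel. X \<omega> * cnj (Y \<omega>) * complex_of_real ((cmod (F (a * \<omega>)))\<^sup>2)))"
    proof -
      \<comment> \<open>This is where the exponent \<open>2 * \<rho> - 3\<close> proves right:
        exactly the scale-invariant weight \<open>1 / \<bar>a\<bar>\<close> remains for
        \<open>K\<close>.\<close>
      have "1 / \<bar>a\<bar> ^ 3 * (\<bar>a\<bar>\<^sup>2 / (2 * pi)) = 1 / (2 * pi) * (1 / \<bar>a\<bar>)"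
        using a by (simp add: power2_eq_square power3_eq_cube)
      then show ?thesis
        by (simp only: mult.assoc[symmetric] of_real_mult[symmetric])
    qed
    also have "complex_of_real (1 / \<bar>a\<bar>) *
        (LINT \<omega>|lborel. X \<omega> * cnj (Y \<omega>) * complex_of_real ((cmod (F (a * \<omega>)))\<^sup>2))
            = (LINT \<omega>|lborel. K a \<omega>)"
      unfolding integral_mult_right_zero[symmetric] K_def
      by (intro Bochner_Integration.integral_cong refl) simp
    finally have "(LINT b|lborel. ?J b) = complex_of_real (1 / (2 * pi)) * (LINT \<omega>|lborel. K a \<omega>)" .
    then show ?thesis
      using lebesgue_integral_eq_lborel(2,3)[OF _ AE] J by simp
  qed
  have good: "AE a in lborel. integrable lebesgue (?I a) \<and> (LINT b|lebesgue. ?I a b)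
      = complex_of_real (1 / (2 * pi)) * (LINT \<omega>|lborel. K a \<omega>)"
    \<comment> \<open>The excluded scales are 0 and those where one of the two products fails to be
      square integrable.\<close>
    using AE_lborel_nonzero AE_square_integrable_dilated_product[OF X F adm']
        AE_square_integrable_dilated_product[OF Y F adm']
    by eventually_elim (rule inner)
  let ?L = "\<lambda>a. complex_of_real (1 / (2 * pi)) * (LINT \<omega>|lborel. K a \<omega>)"
  have L: "integrable lborel ?L"
    by (intro integrable_mult_right K)
  then have L_meas: "?L \<in> borel_measurable borel"
    by (auto dest: borel_measurable_integrable)
  have AEL: "AE a in lborel. (LINT b|lebesgue. ?I a b) = ?L a"
    using good by eventually_elim blast
  have "AE a in lebesgue. integrable lebesgue (?I a)"
    using AE_completion[OF good] by eventually_elim blast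
  moreover have "integrable lebesgue (\<lambda>a. LINT b|lebesgue. ?I a b)"
    using lebesgue_integral_eq_lborel(2)[OF L_meas AEL] L by blast
  \<comment> \<open>The factor \<open>1 / (2 * pi)\<close> in \<open>?L\<close> cancels the
    \<open>2 * pi\<close> that Parseval's identity put into \<open>XY\<close>.\<close>
  moreover have "(LINT a|lebesgue. LINT b|lebesgue. ?I a b)
      = complex_of_real (admissibility_const \<phi>) * L2_inner h g"
    unfolding lebesgue_integral_eq_lborel(3)[OF L_meas AEL] integral_mult_right_zero K by simp
  ultimately show ?thesis by blast
qed

end
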